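(* Let $M$ be a connected complete Riemannian manifold, let $SM$ be its unit tangent bundle, and let $\varphi_t : SM \to SM$ ($t\in\mathbb{R}$) be its geodesic flow. If the geodesic flow is conservative with respect to the Liouville measure $m$ on $SM$, then every continuous convex function $f : M \to \mathbb{R}$ is constant.
   Context: All manifolds are smooth. For $\theta=(p,v)\in TM$ let $\gamma_\theta$ be the geodesic with $\gamma_\theta(0)=p$, $\gamma_\theta'(0)=v$; the geodesic flow is $\varphi_t(\theta)=(\gamma_\theta(t),\gamma_\theta'(t))$. It preserves the unit tangent bundle $SM=\{(p,v)\in TM : |v|=1\}$. The Liouville measure $m$ on $SM$ is the measure given locally by the product of the Riemannian volume on $M$ and the standard measure on the unit spheres of the tangent spaces induced by the Riemannian metric (equivalently, the restriction to $SM$ of the Liouville measure $dx\,dv$ of $TM$); it is invariant under $\varphi_t$. The geodesic flow is conservative with respect to the Liouville measure if, for every measurable set $A\subset SM$, for $m$-almost every $\theta\in A$ there is a sequence $(t_n)_{n\in\mathbb{N}}$ in $\mathbb{R}$ with $t_n\to+\infty$ and $\varphi_{t_n}(\theta)\in A$ for all $n$. A function $f:M\to\mathbb{R}$ is convex if for every geodesic segment $\gamma:[a,b]\to M$ and every $t\in[0,1]$, $f(\gamma((1-t)a+tb))\le(1-t)f(\gamma(a))+tf(\gamma(b))$. Geodesics here are all solutions of the geodesic equation, not only minimizing ones. *)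

theory Defs
  imports "HOL-Analysis.Analysis"
begin

section \<open>Smooth maps and smooth manifolds\<close>

text \<open>Maps of class \<open>C\<^sup>k\<close> on an open set of a Euclidean space: all iterated directional
  derivatives up to order \<open>k\<close> exist and are continuous.\<close>

primrec Ck_on :: "nat \<Rightarrow> 'a::euclidean_space set \<Rightarrow> ('a \<Rightarrow> 'b::real_normed_vector) \<Rightarrow> bool" where
  "Ck_on 0 S f \<longleftrightarrow> continuous_on S f"
| "Ck_on (Suc k) S f \<longleftrightarrow> (\<forall>x\<in>S. f differentiable (at x)) \<and>
     (\<forall>v. Ck_on k S (\<lambda>x. frechet_derivative f (at x) v))"

definition smooth_on :: "'a::euclidean_space set \<Rightarrow> ('a \<Rightarrow> 'b::real_normed_vector) \<Rightarrow> bool" where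
  "smooth_on S f \<longleftrightarrow> (\<forall>k. Ck_on k S f)"

text \<open>A chart is a pair of its domain and its coordinate map; the values of the coordinate map
  outside the domain are irrelevant.\<close>

type_synonym ('a, 'n) chart = "'a set \<times> ('a \<Rightarrow> real ^ 'n)"

definition chart_dom :: "('a, 'n) chart \<Rightarrow> 'a set" where
  "chart_dom c = fst c"

definition chart_map :: "('a, 'n) chart \<Rightarrow> 'a \<Rightarrow> real ^ 'n" where
  "chart_map c = snd c"

definition chart_img :: "('a, 'n) chart \<Rightarrow> (real ^ 'n) set" where
  "chart_img c = chart_map c ` chart_dom c"

definition chart_inv :: "('a, 'n) chart \<Rightarrow> real ^ 'n \<Rightarrow> 'a" where
  "chart_inv c = inv_into (chart_dom c) (chart_map c)"

definition is_chart :: "('a::topological_space, 'n::finite) chart \<Rightarrow> bool" where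
  "is_chart c \<longleftrightarrow> open (chart_dom c) \<and> open (chart_img c) \<and>
     homeomorphism (chart_dom c) (chart_img c) (chart_map c) (chart_inv c)"

text \<open>The manifold is the union of the chart domains.  Hausdorffness and second countability are
  provided by the sort of the ambient type, of which the manifold is an open subset (the whole
  type being a possible choice).\<close>

definition smooth_atlas ::
    "('a::{t2_space, second_countable_topology}, 'n::finite) chart set \<Rightarrow> bool" where
  "smooth_atlas A \<longleftrightarrow> (\<forall>c\<in>A. is_chart c) \<and>
     (\<forall>c\<in>A. \<forall>d\<in>A. smooth_on (chart_map c ` (chart_dom c \<inter> chart_dom d))
                            (chart_map d \<circ> chart_inv c))"

definition manifold_carrier :: "('a, 'n) chart set \<Rightarrow> 'a set" where
  "manifold_carrier A = (\<Union>c\<in>A. chart_dom c)"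

section \<open>Tangent vectors and Riemannian metrics\<close>

definition transition_deriv ::
    "('a, 'n::finite) chart \<Rightarrow> ('a, 'n) chart \<Rightarrow> 'a \<Rightarrow> real ^ 'n \<Rightarrow> real ^ 'n" where
  "transition_deriv c d p = frechet_derivative (chart_map d \<circ> chart_inv c) (at (chart_map c p))"

text \<open>A tangent vector at \<open>p\<close> is the family of its coordinate vectors in all charts of the atlas
  around \<open>p\<close>, related by the derivatives of the transition maps.  For all other charts the
  component is fixed to be 0, so that equal tangent vectors are equal as functions.\<close>

type_synonym ('a, 'n) tangent = "('a, 'n) chart \<Rightarrow> real ^ 'n"

definition tangent_space ::
    "('a, 'n::finite) chart set \<Rightarrow> 'a \<Rightarrow> ('a, 'n) tangent set" where
  "tangent_space A p =
     {v. (\<forall>c\<in>A. \<forall>d\<in>A. p \<in> chart_dom c \<inter> chart_dom d \<longrightarrow> v d = transition_deriv c d p (v c)) \<and>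
         (\<forall>c. c \<notin> A \<or> p \<notin> chart_dom c \<longrightarrow> v c = 0)}"

text \<open>The tangent vector at \<open>p\<close> with coordinate vector \<open>u\<close> in the chart \<open>c\<close>.\<close>

definition tangent_of ::
    "('a, 'n::finite) chart set \<Rightarrow> ('a, 'n) chart \<Rightarrow> 'a \<Rightarrow> real ^ 'n \<Rightarrow> ('a, 'n) tangent" where
  "tangent_of A c p u = (\<lambda>d. if d \<in> A \<and> p \<in> chart_dom d then transition_deriv c d p u else 0)"

definition tangent_bundle ::
    "('a, 'n::finite) chart set \<Rightarrow> ('a \<times> ('a, 'n) tangent) set" where
  "tangent_bundle A = {(p, v). p \<in> manifold_carrier A \<and> v \<in> tangent_space A p}"

type_synonym ('a, 'n) metric = "'a \<Rightarrow> ('a, 'n) tangent \<Rightarrow> ('a, 'n) tangent \<Rightarrow> real"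

text \<open>The coordinate expression \<open>\<Sum>\<^sub>i\<^sub>j g\<^sub>i\<^sub>j(x) u\<^sub>i w\<^sub>j\<close> of a metric in a chart.\<close>

definition local_metric ::
    "('a, 'n::finite) chart set \<Rightarrow> ('a, 'n) metric \<Rightarrow> ('a, 'n) chart \<Rightarrow>
     real ^ 'n \<Rightarrow> real ^ 'n \<Rightarrow> real ^ 'n \<Rightarrow> real" where
  "local_metric A g c x u w =
     g (chart_inv c x) (tangent_of A c (chart_inv c x) u) (tangent_of A c (chart_inv c x) w)"

text \<open>As \<open>tangent_of A c p\<close> is a linear isomorphism onto the tangent space at \<open>p\<close>, the algebraic
  conditions below say that \<open>g p\<close> is an inner product on that space.\<close>

definition riemannian_metric ::
    "('a, 'n::finite) chart set \<Rightarrow> ('a, 'n) metric \<Rightarrow> bool" where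
  "riemannian_metric A g \<longleftrightarrow>
     (\<forall>c\<in>A. (\<forall>u w. smooth_on (chart_img c) (\<lambda>x. local_metric A g c x u w)) \<and>
       (\<forall>x\<in>chart_img c. bilinear (local_metric A g c x) \<and>
          (\<forall>u w. local_metric A g c x u w = local_metric A g c x w u) \<and>
          (\<forall>u. u \<noteq> 0 \<longrightarrow> local_metric A g c x u u > 0)))"

definition unit_tangent_bundle ::
    "('a, 'n::finite) chart set \<Rightarrow> ('a, 'n) metric \<Rightarrow> ('a \<times> ('a, 'n) tangent) set" where
  "unit_tangent_bundle A g = {(p, v) \<in> tangent_bundle A. sqrt (g p v v) = 1}"

section \<open>Geodesics and the geodesic flow\<close>

definition local_metric_deriv ::
    "('a, 'n::finite) chart set \<Rightarrow> ('a, 'n) metric \<Rightarrow> ('a, 'n) chart \<Rightarrow>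
     real ^ 'n \<Rightarrow> real ^ 'n \<Rightarrow> real ^ 'n \<Rightarrow> real ^ 'n \<Rightarrow> real" where
  "local_metric_deriv A g c x z u w = frechet_derivative (\<lambda>y. local_metric A g c y u w) (at x) z"

text \<open>The Christoffel symbols of the Levi-Civita connection as a bilinear map
  \<open>\<Gamma>(u, w) = (\<Sum>\<^sub>i\<^sub>j \<Gamma>\<^sup>k\<^sub>i\<^sub>j u\<^sub>i w\<^sub>j)\<^sub>k\<close>, with the index lowered to avoid inverting the metric:
  \<open>\<Sum>\<^sub>l g\<^sub>k\<^sub>l \<Gamma>\<^sup>l\<^sub>i\<^sub>j = (\<partial>\<^sub>i g\<^sub>j\<^sub>k + \<partial>\<^sub>j g\<^sub>i\<^sub>k - \<partial>\<^sub>k g\<^sub>i\<^sub>j) / 2\<close>.\<close>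

definition christoffel ::
    "('a, 'n::finite) chart set \<Rightarrow> ('a, 'n) metric \<Rightarrow> ('a, 'n) chart \<Rightarrow>
     real ^ 'n \<Rightarrow> real ^ 'n \<Rightarrow> real ^ 'n \<Rightarrow> real ^ 'n" where
  "christoffel A g c x u w = (THE y. \<forall>z. local_metric A g c x y z =
     (local_metric_deriv A g c x u w z + local_metric_deriv A g c x w u z
       - local_metric_deriv A g c x z u w) / 2)"

definition velocity ::
    "('a, 'n::finite) chart set \<Rightarrow> real set \<Rightarrow> (real \<Rightarrow> 'a) \<Rightarrow> real \<Rightarrow> ('a, 'n) tangent" where
  "velocity A I \<gamma> t =
     (\<lambda>c. if c \<in> A \<and> \<gamma> t \<in> chart_dom c
          then vector_derivative (chart_map c \<circ> \<gamma>) (at t within I) else 0)"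

text \<open>Solutions of the geodesic equation \<open>x'' = - \<Gamma>(x', x')\<close> in all charts, on a nondegenerate
  interval \<open>I\<close> (with one-sided derivatives at the end points, if any).\<close>

definition geodesic_on ::
    "('a::topological_space, 'n::finite) chart set \<Rightarrow> ('a, 'n) metric \<Rightarrow>
     real set \<Rightarrow> (real \<Rightarrow> 'a) \<Rightarrow> bool" where
  "geodesic_on A g I \<gamma> \<longleftrightarrow> continuous_on I \<gamma> \<and> \<gamma> ` I \<subseteq> manifold_carrier A \<and>
     (\<forall>c\<in>A. \<forall>t\<in>I. \<gamma> t \<in> chart_dom c \<longrightarrow>
        (chart_map c \<circ> \<gamma>) differentiable (at t within I) \<and>
        ((\<lambda>s. velocity A I \<gamma> s c) has_vector_derivative
           - christoffel A g c (chart_map c (\<gamma> t)) (velocity A I \<gamma> t c) (velocity A I \<gamma> t c))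
          (at t within I))"

definition geodesically_complete ::
    "('a::topological_space, 'n::finite) chart set \<Rightarrow> ('a, 'n) metric \<Rightarrow> bool" where
  "geodesically_complete A g \<longleftrightarrow> (\<forall>(p, v)\<in>tangent_bundle A.
     \<exists>\<gamma>. geodesic_on A g UNIV \<gamma> \<and> \<gamma> 0 = p \<and> velocity A UNIV \<gamma> 0 = v)"

definition the_geodesic ::
    "('a::topological_space, 'n::finite) chart set \<Rightarrow> ('a, 'n) metric \<Rightarrow>
     'a \<times> ('a, 'n) tangent \<Rightarrow> real \<Rightarrow> 'a" where
  "the_geodesic A g \<theta> = (THE \<gamma>. geodesic_on A g UNIV \<gamma> \<and>
     \<gamma> 0 = fst \<theta> \<and> velocity A UNIV \<gamma> 0 = snd \<theta>)"

definition geodesic_flow ::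
    "('a::topological_space, 'n::finite) chart set \<Rightarrow> ('a, 'n) metric \<Rightarrow> real \<Rightarrow>
     'a \<times> ('a, 'n) tangent \<Rightarrow> 'a \<times> ('a, 'n) tangent" where
  "geodesic_flow A g t \<theta> = (the_geodesic A g \<theta> t, velocity A UNIV (the_geodesic A g \<theta>) t)"

section \<open>The Liouville measure\<close>

definition bundle_chart ::
    "('a, 'n) chart \<Rightarrow> 'a \<times> ('a, 'n) tangent \<Rightarrow> (real ^ 'n) \<times> (real ^ 'n)" where
  "bundle_chart c \<theta> = (chart_map c (fst \<theta>), snd \<theta> c)"

text \<open>The open sets of the manifold topology of the tangent bundle.\<close>

definition open_tangent_bundle ::
    "('a, 'n::finite) chart set \<Rightarrow> ('a \<times> ('a, 'n) tangent) set \<Rightarrow> bool" where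
  "open_tangent_bundle A W \<longleftrightarrow> W \<subseteq> tangent_bundle A \<and>
     (\<forall>c\<in>A. open (bundle_chart c ` {\<theta> \<in> W. fst \<theta> \<in> chart_dom c}))"

definition borel_unit_tangent_bundle ::
    "('a, 'n::finite) chart set \<Rightarrow> ('a, 'n) metric \<Rightarrow> ('a \<times> ('a, 'n) tangent) set set" where
  "borel_unit_tangent_bundle A g = sigma_sets (unit_tangent_bundle A g)
     {W \<inter> unit_tangent_bundle A g | W. open_tangent_bundle A W}"

text \<open>The density \<open>\<surd>(det (g\<^sub>i\<^sub>j(x)))\<close>, with respect to Lebesgue measure, of the Riemannian volume
  in a chart, and of the volume of the inner product \<open>(g\<^sub>i\<^sub>j(x))\<close> on the tangent space.\<close>

definition volume_density ::
    "('a, 'n::finite) chart set \<Rightarrow> ('a, 'n) metric \<Rightarrow> ('a, 'n) chart \<Rightarrow> real ^ 'n \<Rightarrow> real" where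
  "volume_density A g c x =
     sqrt (det (\<chi> i j. local_metric A g c x (axis i 1) (axis j 1)))"

text \<open>The surface measure of a Borel set \<open>B\<close> of unit vectors of the inner product space of
  dimension \<open>n\<close> given by the metric at \<open>x\<close>: it is \<open>n\<close> times the volume of the cone over \<open>B\<close>.
  For \<open>n = 1\<close> this is counting measure on the two unit vectors.\<close>

definition unit_sphere_measure ::
    "('a, 'n::finite) chart set \<Rightarrow> ('a, 'n) metric \<Rightarrow> ('a, 'n) chart \<Rightarrow> real ^ 'n \<Rightarrow>
     (real ^ 'n) set \<Rightarrow> ennreal" where
  "unit_sphere_measure A g c x B = ennreal (real CARD('n) * volume_density A g c x) *
     emeasure lborel {r *\<^sub>R w | r w. 0 < r \<and> r \<le> 1 \<and> w \<in> B}"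

text \<open>The measure on the Borel sets of the unit tangent bundle that in each chart is the product of
  the Riemannian volume and the surface measures of the unit spheres.  Countably many charts cover
  the manifold, so these conditions determine the measure.\<close>

definition is_liouville_measure ::
    "('a, 'n::finite) chart set \<Rightarrow> ('a, 'n) metric \<Rightarrow> ('a \<times> ('a, 'n) tangent) measure \<Rightarrow> bool" where
  "is_liouville_measure A g m \<longleftrightarrow>
     space m = unit_tangent_bundle A g \<and> sets m = borel_unit_tangent_bundle A g \<and>
     (\<forall>c\<in>A. \<forall>B\<in>sets m. B \<subseteq> {\<theta>. fst \<theta> \<in> chart_dom c} \<longrightarrow>
        emeasure m B = (\<integral>\<^sup>+x\<in>chart_img c. ennreal (volume_density A g c x) *
          unit_sphere_measure A g c x {v c | v. (chart_inv c x, v) \<in> B} \<partial>lborel))"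

section \<open>Conservative flows and convex functions\<close>

definition conservative :: "'b measure \<Rightarrow> (real \<Rightarrow> 'b \<Rightarrow> 'b) \<Rightarrow> bool" where
  "conservative m \<phi> \<longleftrightarrow> (\<forall>B\<in>sets m. AE \<theta> in m. \<theta> \<in> B \<longrightarrow>
     (\<exists>t :: nat \<Rightarrow> real. filterlim t at_top sequentially \<and> (\<forall>n. \<phi> (t n) \<theta> \<in> B)))"

definition geodesically_convex ::
    "('a::topological_space, 'n::finite) chart set \<Rightarrow> ('a, 'n) metric \<Rightarrow> ('a \<Rightarrow> real) \<Rightarrow> bool" where
  "geodesically_convex A g f \<longleftrightarrow> (\<forall>a b \<gamma>. a < b \<longrightarrow> geodesic_on A g {a..b} \<gamma> \<longrightarrow>
     (\<forall>t\<in>{0..1}. f (\<gamma> ((1 - t) * a + t * b)) \<le> (1 - t) * f (\<gamma> a) + t * f (\<gamma> b)))"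

end

theory Submission
  imports Defs
begin

text \<open>
  Along a geodesic \<open>\<gamma>\<close> the function \<open>f \<circ> \<gamma>\<close> is convex, and if it returns arbitrarily late to values
  arbitrarily close to \<open>f (\<gamma> 0)\<close>, it is constant on \<open>[0, \<infinity>)\<close>.  Conservativity, applied to the
  sets where \<open>f\<close> takes values in a rational interval, yields this for almost every unit vector.
  Nonempty open sets of unit vectors have positive Liouville measure, so these vectors are dense,
  and by continuous dependence on initial conditions (Gronwall's inequality in a chart) \<open>f\<close> is
  constant along every short geodesic.  The short geodesics from a point cover a neighbourhood of
  it, so \<open>f\<close> is locally constant and hence constant.
\<close>

text \<open>The Christoffel symbols, the geodesic with given initial data and hence the flow are
  definite descriptions, with no formula to compute from. So existence and uniqueness come first,
  and every quantitative fact about geodesics is read off from one autonomous first-order system in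
  a chart, whose right-hand side is Lipschitz on products of compact convex sets with balls of
  velocities. The passage from almost every vector to every vector rests on uniformity: one radius,
  one time \<epsilon> and one constant serve all geodesics that start near a point with bounded
  velocity, so a limit of good geodesics stays within a single chart. Recurrence acts in two ways.
  Late values below a fixed bound forbid any increase of a convex function, since an increase
  continues at least linearly. Once the function is known to be nonincreasing, late values above a
  fixed bound forbid a decrease, since it could never be made up. The measure lives on unit vectors,
  so constancy is obtained for unit speed only; the exponential map is therefore written in polar
  form, with the length of the vector as the time.\<close>

section \<open>Preliminaries from analysis\<close>

lemma smooth_on_continuous: "smooth_on S f \<Longrightarrow> continuous_on S f"
  unfolding smooth_on_def by (metis Ck_on.simps(1))

lemma smooth_on_differentiable: "smooth_on S f \<Longrightarrow> x \<in> S \<Longrightarrow> f differentiable (at x)"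
  unfolding smooth_on_def by (metis Ck_on.simps(2))

lemma smooth_on_frechet:
  "smooth_on S f \<Longrightarrow> smooth_on S (\<lambda>x. frechet_derivative f (at x) v)"
  unfolding smooth_on_def by (metis Ck_on.simps(2))

lemma smooth_on_has_derivative:
  "smooth_on S f \<Longrightarrow> x \<in> S \<Longrightarrow> (f has_derivative frechet_derivative f (at x)) (at x)"
  using smooth_on_differentiable frechet_derivative_works by blast

lemma linear_eq_sum_Basis:
  fixes h :: "'a::euclidean_space \<Rightarrow> 'b::real_vector"
  assumes "linear h"
  shows "h v = (\<Sum>b\<in>Basis. (v \<bullet> b) *\<^sub>R h b)"
proof -
  have "h v = h (\<Sum>b\<in>Basis. (v \<bullet> b) *\<^sub>R b)"
    by (simp add: euclidean_representation)
  also have "\<dots> = (\<Sum>b\<in>Basis. (v \<bullet> b) *\<^sub>R h b)"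
    using assms by (simp add: linear_sum linear_cmul)
  finally show ?thesis .
qed

lemma linear_norm_le_Basis:
  fixes h :: "'a::euclidean_space \<Rightarrow> 'b::real_normed_vector"
  assumes "linear h" and "\<And>b. b \<in> Basis \<Longrightarrow> norm (h b) \<le> \<beta>"
  shows "norm (h v) \<le> real DIM('a) * \<beta> * norm v"
proof -
  have "norm (h v) \<le> (\<Sum>b\<in>(Basis::'a set). norm ((v \<bullet> b) *\<^sub>R h b))"
    unfolding linear_eq_sum_Basis[OF assms(1), of v] by (rule norm_sum)
  also have "\<dots> \<le> (\<Sum>b\<in>(Basis::'a set). norm v * \<beta>)"
    by (intro sum_mono) (auto intro!: mult_mono assms(2) Basis_le_norm)
  finally show ?thesis by (simp add: mult_ac)
qed

text \<open>The sum of the absolute values of the individual constants dominates each of them.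
  Taking a sum instead of a maximum also covers the empty index set.\<close>

lemma finite_uniform_bound:
  fixes P :: "'i \<Rightarrow> real \<Rightarrow> bool"
  assumes "finite I" and "\<And>i. i \<in> I \<Longrightarrow> \<exists>C. P i C"
    and "\<And>i C C'. P i C \<Longrightarrow> C \<le> C' \<Longrightarrow> P i C'"
  shows "\<exists>C\<ge>0. \<forall>i\<in>I. P i C"
proof -
  obtain c where c: "\<And>i. i \<in> I \<Longrightarrow> P i (c i)" using assms(2) by metis
  have "\<forall>i\<in>I. P i (\<Sum>i\<in>I. \<bar>c i\<bar>)"
  proof
    fix i assume "i \<in> I"
    then have "c i \<le> (\<Sum>i\<in>I. \<bar>c i\<bar>)"
      using member_le_sum[of i I "\<lambda>i. \<bar>c i\<bar>"] assms(1) by force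
    then show "P i (\<Sum>i\<in>I. \<bar>c i\<bar>)" using assms(3) c \<open>i \<in> I\<close> by blast
  qed
  then show ?thesis by (meson abs_ge_zero sum_nonneg)
qed

lemma frechet_eq_sum_Basis:
  assumes "smooth_on S f" "x \<in> S"
  shows "frechet_derivative f (at x) v = (\<Sum>b\<in>Basis. (v \<bullet> b) *\<^sub>R frechet_derivative f (at x) b)"
  by (intro linear_eq_sum_Basis linear_frechet_derivative smooth_on_differentiable[OF assms])

text \<open>Smoothness gives continuity in the base point for each fixed direction. Joint continuity
  follows because the derivative is a combination of finitely many such functions with coefficients
  linear in the direction. It is what makes the coordinate changes of the tangent bundle
  continuous.\<close>

lemma continuous_on_frechet:
  fixes f :: "'a::euclidean_space \<Rightarrow> 'b::real_normed_vector"
  assumes "smooth_on S f"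
  shows "continuous_on (S \<times> UNIV) (\<lambda>(x, v). frechet_derivative f (at x) v)"
proof -
  have "continuous_on (S \<times> UNIV)
    (\<lambda>q. \<Sum>b\<in>Basis. (snd q \<bullet> b) *\<^sub>R frechet_derivative f (at (fst q)) b)"
    by (intro continuous_intros continuous_on_compose2[OF smooth_on_continuous[OF
          smooth_on_frechet[OF assms]]]) auto
  then show ?thesis
    by (rule continuous_on_eq) (auto simp: frechet_eq_sum_Basis[OF assms, symmetric])
qed

lemma smooth_on_bounded:
  assumes "smooth_on S f" "compact K" "K \<subseteq> S"
  shows "\<exists>C. \<forall>x\<in>K. norm (f x) \<le> C"
proof -
  have "compact (f ` K)"
    by (meson assms compact_continuous_image continuous_on_subset smooth_on_continuous)
  then show ?thesis by (auto dest!: compact_imp_bounded simp: bounded_iff)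
qed

lemma smooth_family_bounded:
  assumes "finite I" "\<And>i. i \<in> I \<Longrightarrow> smooth_on S (h i)" "compact K" "K \<subseteq> S"
  shows "\<exists>C\<ge>0. \<forall>i\<in>I. \<forall>x\<in>K. norm (h i x) \<le> C"
proof (rule finite_uniform_bound[OF assms(1)])
  show "\<exists>C. \<forall>x\<in>K. norm (h i x) \<le> C" if "i \<in> I" for i
    by (rule smooth_on_bounded[OF assms(2)[OF that] assms(3,4)])
qed (meson order_trans)

text \<open>The mean value inequality on a convex set; the operator norm of the derivative is
  controlled by its values on basis vectors, which are continuous in the base point and so bounded
  on \<open>K\<close>.\<close>

lemma smooth_on_lipschitz:
  fixes f :: "'a::euclidean_space \<Rightarrow> 'b::real_normed_vector"
  assumes f: "smooth_on S f" and K: "compact K" "convex K" "K \<subseteq> S"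
  shows "\<exists>C. \<forall>x\<in>K. \<forall>y\<in>K. norm (f x - f y) \<le> C * norm (x - y)"
proof -
  obtain C where C: "\<And>b x. b \<in> Basis \<Longrightarrow> x \<in> K \<Longrightarrow> norm (frechet_derivative f (at x) b) \<le> C"
    using smooth_family_bounded[of Basis S "\<lambda>b x. frechet_derivative f (at x) b", OF finite_Basis smooth_on_frechet[OF f] K(1,3)]
    by blast
  have "norm (f x - f y) \<le> (real DIM('a) * C) * norm (x - y)" if "x \<in> K" "y \<in> K" for x y
  proof (rule differentiable_bound[OF K(2) _ _ that])
    fix z assume z: "z \<in> K"
    show "(f has_derivative frechet_derivative f (at z)) (at z within K)"
      using smooth_on_has_derivative[OF f] z K has_derivative_at_withinI by blast
    show "onorm (frechet_derivative f (at z)) \<le> real DIM('a) * C"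
      by (rule onorm_le, rule linear_norm_le_Basis[OF linear_frechet_derivative C])
        (use z K smooth_on_differentiable[OF f] in auto)
  qed
  then show ?thesis by blast
qed

lemma smooth_family_lipschitz:
  assumes "finite I" "\<And>i. i \<in> I \<Longrightarrow> smooth_on S (h i)" "compact K" "convex K" "K \<subseteq> S"
  shows "\<exists>C\<ge>0. \<forall>i\<in>I. \<forall>x\<in>K. \<forall>y\<in>K. norm (h i x - h i y) \<le> C * norm (x - y)"
proof (rule finite_uniform_bound[OF assms(1)])
  show "\<exists>C. \<forall>x\<in>K. \<forall>y\<in>K. norm (h i x - h i y) \<le> C * norm (x - y)" if "i \<in> I" for i
    by (rule smooth_on_lipschitz[OF assms(2)[OF that] assms(3-5)])
qed (meson order_trans mult_right_mono norm_ge_zero)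

lemma bilinear_eq_sum_Basis:
  fixes h :: "'a::euclidean_space \<Rightarrow> 'a \<Rightarrow> real"
  assumes "bilinear h"
  shows "h u w = (\<Sum>i\<in>Basis. \<Sum>j\<in>Basis. (u \<bullet> i) * (w \<bullet> j) * h i j)"
proof -
  have "h u w = (\<Sum>i\<in>Basis. (u \<bullet> i) *\<^sub>R h i w)"
    by (rule linear_eq_sum_Basis) (use assms in \<open>simp add: bilinear_def\<close>)
  also have "\<dots> = (\<Sum>i\<in>Basis. (u \<bullet> i) *\<^sub>R (\<Sum>j\<in>Basis. (w \<bullet> j) *\<^sub>R h i j))"
    by (intro sum.cong refl arg_cong2[of _ _ _ _ "(*\<^sub>R)"] linear_eq_sum_Basis)
      (use assms in \<open>simp add: bilinear_def\<close>)
  finally show ?thesis by (simp add: sum_distrib_left mult.assoc)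
qed

text \<open>The form in which ellipticity is exploited: testing an equation with its own solution
  gives a quadratic lower bound and a linear upper bound.\<close>

lemma le_div_if_square_le:
  fixes \<mu> :: real
  assumes "\<mu> > 0" "\<mu> * z\<^sup>2 \<le> B * z" "z \<ge> 0" "B \<ge> 0"
  shows "z \<le> B / \<mu>"
proof (cases "z = 0")
  case False
  then have "\<mu> * z \<le> B" using assms(2,3) by (simp add: power2_eq_square)
  then show ?thesis using assms(1) by (simp add: pos_le_divide_eq mult.commute)
qed (use assms in auto)

text \<open>The squared distance of the two solutions grows at rate at most \<open>2 * L\<close>, so
  the weight \<open>exp (- 2 * L * t)\<close> makes it nonincreasing. The square is used because the
  norm itself need not be differentiable where the solutions meet.\<close>

lemma gronwall_lipschitz:
  fixes X Y :: "real \<Rightarrow> 'b::real_inner"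
  assumes F: "L-lipschitz_on U F" and T: "0 \<le> T"
    and X: "\<And>t. t \<in> {0..T} \<Longrightarrow> (X has_vector_derivative F (X t)) (at t)"
      "\<And>t. t \<in> {0..T} \<Longrightarrow> X t \<in> U"
    and Y: "\<And>t. t \<in> {0..T} \<Longrightarrow> (Y has_vector_derivative F (Y t)) (at t)"
      "\<And>t. t \<in> {0..T} \<Longrightarrow> Y t \<in> U"
  shows "norm (X T - Y T) \<le> exp (L * T) * norm (X 0 - Y 0)"
proof -
  define Z where "Z t = X t - Y t" for t
  define \<phi> where "\<phi> t = (Z t \<bullet> Z t) * exp (- 2 * L * t)" for t
  have "\<phi> T \<le> \<phi> 0"
  proof (rule DERIV_nonpos_imp_nonincreasing[OF T])
    fix t assume t: "0 \<le> t" "t \<le> T"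
    define W where "W = F (X t) - F (Y t)"
    have "(Z has_vector_derivative W) (at t)"
      unfolding Z_def W_def using X(1) Y(1) t by (auto intro!: has_vector_derivative_diff)
    from bounded_bilinear.has_vector_derivative[OF bounded_bilinear_inner this this]
    have "((\<lambda>t. Z t \<bullet> Z t) has_real_derivative 2 * (Z t \<bullet> W)) (at t)"
      by (simp add: has_real_derivative_iff_has_vector_derivative inner_commute)
    then have "(\<phi> has_real_derivative
        (2 * (Z t \<bullet> W) * exp (- 2 * L * t) + (Z t \<bullet> Z t) * (exp (- 2 * L * t) * (- 2 * L)))) (at t)"
      unfolding \<phi>_def by (auto intro!: derivative_eq_intros simp: algebra_simps)
    moreover have "Z t \<bullet> W \<le> L * (Z t \<bullet> Z t)"
    proof -
      have "norm W \<le> L * norm (Z t)"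
        using lipschitz_onD[OF F, of "X t" "Y t"] X(2) Y(2) t by (simp add: W_def Z_def dist_norm)
      then have "norm (Z t) * norm W \<le> norm (Z t) * (L * norm (Z t))"
        by (rule mult_left_mono) simp
      then show ?thesis using norm_cauchy_schwarz[of "Z t" W]
        by (simp add: dot_square_norm power2_eq_square mult_ac)
    qed
    then have "(2 * (Z t \<bullet> W) - 2 * L * (Z t \<bullet> Z t)) * exp (- 2 * L * t) \<le> 0"
      by (intro mult_nonpos_nonneg) auto
    then have "2 * (Z t \<bullet> W) * exp (- 2 * L * t) + (Z t \<bullet> Z t) * (exp (- 2 * L * t) * (- 2 * L)) \<le> 0"
      by (simp add: algebra_simps)
    ultimately show "\<exists>y. DERIV \<phi> t :> y \<and> y \<le> 0" by blast
  qed
  then have "(Z T \<bullet> Z T) * exp (- 2 * L * T) * exp (2 * L * T) \<le> (Z 0 \<bullet> Z 0) * exp (2 * L * T)"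
    unfolding \<phi>_def by (intro mult_right_mono) auto
  then have "(norm (Z T))\<^sup>2 \<le> (exp (L * T) * norm (Z 0))\<^sup>2"
    by (simp add: dot_square_norm exp_minus power_mult_distrib mult_ac flip: exp_double)
  then show ?thesis unfolding Z_def by (rule power2_le_imp_le) auto
qed

lemma linear_eq_sum_axis:
  fixes h :: "real ^ 'n \<Rightarrow> 'b::real_vector"
  assumes "linear h"
  shows "h u = (\<Sum>i\<in>UNIV. (u $ i) *\<^sub>R h (axis i 1))"
proof -
  have "h u = h (\<Sum>i\<in>UNIV. (u $ i) *\<^sub>R axis i 1)"
    using basis_expansion[of u] by (simp add: scalar_mult_eq_scaleR)
  also have "\<dots> = (\<Sum>i\<in>UNIV. (u $ i) *\<^sub>R h (axis i 1))"
    using assms by (simp add: linear_sum linear_cmul)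
  finally show ?thesis .
qed

text \<open>The segment from the identity to \<open>M\<close> consists of positive definite, hence
  invertible, matrices. The determinant starts at 1 and cannot change sign along it without
  vanishing.\<close>

lemma det_pos_if_positive_definite:
  fixes M :: "real ^ 'n ^ 'n"
  assumes "\<And>u. u \<noteq> 0 \<Longrightarrow> u \<bullet> (M *v u) > 0"
  shows "det M > 0"
proof (rule ccontr)
  assume neg: "\<not> det M > 0"
  define P where "P t = (1 - t) *\<^sub>R mat 1 + t *\<^sub>R M" for t :: real
  have "continuous_on {0..1} (\<lambda>t. det (P t))"
    unfolding P_def det_def by (intro continuous_intros)
  then obtain t where t: "0 \<le> t" "t \<le> 1" "det (P t) = 0"
    using IVT2'[of "\<lambda>t. det (P t)" 1 0 0] neg by (force simp: P_def)
  have pos: "u \<bullet> (P t *v u) > 0" if "u \<noteq> 0" for u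
  proof -
    have "u \<bullet> (P t *v u) = (1 - t) * (u \<bullet> u) + t * (u \<bullet> (M *v u))"
      by (simp add: P_def matrix_vector_mult_add_rdistrib scaleR_matrix_vector_assoc[symmetric] inner_add_right)
    moreover have "0 < u \<bullet> u" "0 < u \<bullet> (M *v u)" using assms[OF that] that by auto
    ultimately show ?thesis using t
      by (cases "t = 0") (auto intro: add_nonneg_pos mult_nonneg_nonneg)
  qed
  have "u = 0" if "P t *v u = 0" for u
    using pos[of u] that by (cases "u = 0") auto
  then have "invertible (P t)"
    using invertible_left_inverse matrix_left_invertible_ker by blast
  then show False using t(3) invertible_det_nz by blast
qed

lemma emeasure_lborel_open_pos:
  fixes V :: "'b::euclidean_space set"
  assumes "open V" "V \<noteq> {}"
  shows "emeasure lborel V > 0"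
proof (rule ccontr)
  assume "\<not> 0 < emeasure lborel V"
  then have "V \<in> null_sets lborel" using assms by (auto simp: null_sets_def)
  then have "negligible V" by (simp add: negligible_iff_null_sets null_sets_completionI)
  then show False using open_not_negligible assms by blast
qed

text \<open>The upper ends of the intervals of recurrence make \<open>h\<close> nonincreasing on the
  whole line; their lower ends then exclude a strict decrease after time 0.\<close>

lemma recurrent_convex_constant:
  fixes h :: "real \<Rightarrow> real"
  assumes conv: "\<And>a b \<tau>. a < b \<Longrightarrow> \<tau> \<in> {0..1} \<Longrightarrow> h ((1 - \<tau>) * a + \<tau> * b) \<le> (1 - \<tau>) * h a + \<tau> * h b"
    and rec: "\<And>a b :: rat. of_rat a < h 0 \<Longrightarrow> h 0 < of_rat b \<Longrightarrow>
      \<exists>s :: nat \<Rightarrow> real. filterlim s at_top sequentially \<and> (\<forall>n. of_rat a < h (s n) \<and> h (s n) < of_rat b)"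
    and t: "0 \<le> t"
  shows "h t = h 0"
proof -
  \<comment> \<open>The chord inequality with denominators cleared, so that the comparisons below
    involve products only.\<close>
  have slope: "(c - a) * h b \<le> (c - b) * h a + (b - a) * h c" if "a < b" "b < c" for a b c
  proof -
    let ?\<tau> = "(b - a) / (c - a)"
    have \<tau>: "?\<tau> * (c - a) = b - a" using that by simp
    have eq: "(1 - ?\<tau>) * a + ?\<tau> * c = b"
      using \<tau> by (simp only: algebra_simps)
    have "h b \<le> (1 - ?\<tau>) * h a + ?\<tau> * h c"
      using conv[of a c ?\<tau>] that unfolding eq by simp
    then have "(c - a) * h b \<le> (c - a) * ((1 - ?\<tau>) * h a + ?\<tau> * h c)"
      using that by (intro mult_left_mono) auto
    also have "\<dots> = (c - a - ?\<tau> * (c - a)) * h a + (?\<tau> * (c - a)) * h c"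
      by (simp only: algebra_simps)
    finally show ?thesis unfolding \<tau> by simp
  qed
  have far: "\<exists>T\<ge>Z. of_rat a < h T \<and> h T < of_rat b" if ab: "of_rat a < h 0" "h 0 < of_rat b" for a b Z
  proof -
    obtain s :: "nat \<Rightarrow> real" where s: "filterlim s at_top sequentially"
      "\<And>n. of_rat a < h (s n) \<and> h (s n) < of_rat b" using rec[OF ab] by blast
    have "\<forall>\<^sub>F n in sequentially. Z \<le> s n" using s(1) by (simp add: filterlim_at_top)
    then show ?thesis using s(2) by (meson eventually_sequentially order_refl)
  qed
  obtain a0 where a0: "of_rat a0 < h 0" using of_rat_dense[of "h 0 - 1" "h 0"] by auto
  obtain b0 where b0: "h 0 < of_rat b0" using of_rat_dense[of "h 0" "h 0 + 1"] by auto
  have mono: "h b \<le> h a" if "a < b" for a b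
  proof (rule ccontr)
    assume "\<not> h b \<le> h a"
    then have \<delta>: "h b - h a > 0" by simp
    \<comment> \<open>Beyond \<open>Z\<close> the line through the points of the graph over
      \<open>a\<close> and \<open>b\<close> lies above \<open>b0\<close>, and the convex function
      lies above that line once \<open>T > b\<close>; the first entry of the maximum ensures the
      latter.\<close>
    define Z where "Z = max (b + 1) (a + (b - a) * \<bar>of_rat b0 - h a\<bar> / (h b - h a) + 1)"
    obtain T where T: "T \<ge> Z" "h T < of_rat b0" using far[OF a0 b0] by blast
    then have "b < T" "(b - a) * \<bar>of_rat b0 - h a\<bar> / (h b - h a) < T - a" unfolding Z_def by auto
    then have "(b - a) * \<bar>of_rat b0 - h a\<bar> < (T - a) * (h b - h a)"
      using \<delta> by (simp add: pos_divide_less_eq)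
    moreover have "(T - a) * (h b - h a) \<le> (b - a) * (h T - h a)"
      using slope[OF that \<open>b < T\<close>] by (simp add: algebra_simps)
    moreover have "(b - a) * (h T - h a) \<le> (b - a) * \<bar>of_rat b0 - h a\<bar>"
      using T(2) that by (intro mult_left_mono) auto
    ultimately show False by linarith
  qed
  show ?thesis
  proof (rule ccontr)
    assume "h t \<noteq> h 0"
    then have "h t < h 0" using mono[of 0 t] t by (cases "t = 0") auto
    \<comment> \<open>A rational barrier strictly between the two values: \<open>h\<close> returns
      above it at some \<open>T \<ge> t\<close>, whereas monotonicity keeps it at most
      \<open>h t\<close>.\<close>
    then obtain a where a: "h t < of_rat a" "of_rat a < h 0" using of_rat_dense by blast
    obtain T where T: "T \<ge> t" "of_rat a < h T" using far[OF a(2) b0] by blast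
    then have "h T \<le> h t" using mono[of t T] by (cases "T = t") auto
    then show False using T a by linarith
  qed
qed

lemma AE_ex_in_positive_set:
  assumes "AE \<theta> in m. P \<theta>" "B \<in> sets m" "emeasure m B > 0"
  shows "\<exists>\<theta>\<in>B. P \<theta>"
proof (rule ccontr)
  assume "\<not> (\<exists>\<theta>\<in>B. P \<theta>)"
  then have "AE \<theta> in m. \<theta> \<notin> B" using assms(1) by (auto elim: eventually_mono)
  then have "B \<in> null_sets m" using AE_iff_null_sets[OF assms(2)] by blast
  then show False using assms(3) by (simp add: null_sets_def)
qed

section \<open>Riemannian metrics on open sets\<close>

text \<open>The coordinate expression of a metric in one chart, detached from the manifold so that
  all estimates take place in Euclidean space. It is instantiated with \<open>chart_img c\<close>
  and \<open>local_metric A g c\<close>. Nothing is known about \<open>G x\<close> for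
  \<open>x\<close> outside \<open>S\<close>.\<close>

locale local_riemannian =
  fixes S :: "'a::euclidean_space set" and G :: "'a \<Rightarrow> 'a \<Rightarrow> 'a \<Rightarrow> real"
  assumes open_S: "open S"
    and smooth_G: "\<And>u w. smooth_on S (\<lambda>x. G x u w)"
    and bilinear_G: "\<And>x. x \<in> S \<Longrightarrow> bilinear (G x)"
    and sym_G: "\<And>x u w. x \<in> S \<Longrightarrow> G x u w = G x w u"
    and pos_G: "\<And>x u. x \<in> S \<Longrightarrow> u \<noteq> 0 \<Longrightarrow> G x u u > 0"
begin

definition D :: "'a \<Rightarrow> 'a \<Rightarrow> 'a \<Rightarrow> 'a \<Rightarrow> real" where
  "D x z u w = frechet_derivative (\<lambda>y. G y u w) (at x) z"

definition Christoffel :: "'a \<Rightarrow> 'a \<Rightarrow> 'a \<Rightarrow> 'a" where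
  "Christoffel x u w = (THE y. \<forall>z. G x y z = (D x u w z + D x w u z - D x z u w) / 2)"

lemma smooth_D: "smooth_on S (\<lambda>x. D x z u w)"
  unfolding D_def by (rule smooth_on_frechet[OF smooth_G])

lemma linear_D1: "x \<in> S \<Longrightarrow> linear (\<lambda>z. D x z u w)"
  unfolding D_def using smooth_on_differentiable[OF smooth_G] linear_frechet_derivative by blast

lemma has_derivative_G: "x \<in> S \<Longrightarrow> ((\<lambda>y. G y u w) has_derivative (\<lambda>z. D x z u w)) (at x)"
  unfolding D_def by (rule smooth_on_has_derivative[OF smooth_G])

text \<open>The tool for linearity of \<open>D\<close> in the vector slots: bilinearity of
  \<open>G y\<close> is available only for \<open>y\<close> in \<open>S\<close>, but a derivative at
  \<open>x\<close> sees only the open set \<open>S\<close>, so any function agreeing with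
  \<open>G\<close> there may replace it.\<close>

lemma D_eqI:
  assumes "x \<in> S" "((\<lambda>y. h y) has_derivative h') (at x)" "\<And>y. y \<in> S \<Longrightarrow> h y = G y u w"
  shows "D x z u w = h' z"
proof -
  have "((\<lambda>y. G y u w) has_derivative h') (at x)"
    using has_derivative_transform_within_open[OF assms(2) open_S assms(1,3)] .
  then show ?thesis using has_derivative_unique[OF has_derivative_G[OF assms(1)]] by metis
qed

lemma G_add: "x \<in> S \<Longrightarrow> G x (u + v) w = G x u w + G x v w"
    "x \<in> S \<Longrightarrow> G x w (u + v) = G x w u + G x w v"
  and G_scale: "x \<in> S \<Longrightarrow> G x (k *\<^sub>R u) w = k * G x u w"
    "x \<in> S \<Longrightarrow> G x w (k *\<^sub>R u) = k * G x w u"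
  and G_diff: "x \<in> S \<Longrightarrow> G x (u - v) w = G x u w - G x v w"
    "x \<in> S \<Longrightarrow> G x w (u - v) = G x w u - G x w v"
  by (simp_all add: bilinear_G bilinear_ladd bilinear_radd bilinear_lmul bilinear_rmul
      bilinear_lsub bilinear_rsub)

lemma linear_D2: assumes "x \<in> S" shows "linear (\<lambda>u. D x z u w)"
proof (rule linearI)
  show "D x z (u + v) w = D x z u w + D x z v w" for u v
    by (rule D_eqI[OF assms has_derivative_add[OF has_derivative_G[OF assms] has_derivative_G[OF assms]]])
      (simp add: G_add)
  show "D x z (k *\<^sub>R u) w = k *\<^sub>R D x z u w" for k u
    by (rule D_eqI[OF assms has_derivative_scaleR_right[OF has_derivative_G[OF assms]]])
      (simp add: G_scale)
qed

lemma linear_D3: assumes "x \<in> S" shows "linear (\<lambda>w. D x z u w)"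
proof (rule linearI)
  show "D x z u (w + v) = D x z u w + D x z u v" for w v
    by (rule D_eqI[OF assms has_derivative_add[OF has_derivative_G[OF assms] has_derivative_G[OF assms]]])
      (simp add: G_add)
  show "D x z u (k *\<^sub>R w) = k *\<^sub>R D x z u w" for k w
    by (rule D_eqI[OF assms has_derivative_scaleR_right[OF has_derivative_G[OF assms]]])
      (simp add: G_scale)
qed

lemma G_nonneg: "x \<in> S \<Longrightarrow> G x u u \<ge> 0"
  using pos_G[of x u] bilinear_lzero[OF bilinear_G, of x u] by (cases "u = 0") auto

text \<open>The map \<open>h\<close> lists the values of \<open>G x y\<close> on the standard basis.
  Positive definiteness makes it injective, hence bijective by dimension. This is what gives the
  definite description of the Christoffel symbols a meaning.\<close>

lemma riesz:
  assumes "x \<in> S" "linear l"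
  shows "\<exists>!y. \<forall>z. G x y z = l z"
proof -
  define h where "h y = (\<Sum>i\<in>Basis. G x y i *\<^sub>R i)" for y
  have hi: "h y \<bullet> i = G x y i" if "i \<in> Basis" for y i
    using that unfolding h_def by (simp add: inner_sum_left inner_Basis if_distrib cong: if_cong)
  have lin: "linear h"
    by (rule linearI; rule euclidean_eqI) (simp_all add: hi inner_add_left G_add G_scale assms(1))
  have eq: "(\<forall>z. G x y z = l z) \<longleftrightarrow> (\<forall>i\<in>Basis. G x y i = l i)" for y
  proof
    assume "\<forall>i\<in>Basis. G x y i = l i"
    moreover have "linear (G x y)" using bilinear_G[OF assms(1)] by (simp add: bilinear_def)
    ultimately show "\<forall>z. G x y z = l z" using linear_eq_stdbasis[of "G x y" l] assms(2) by metis
  qed blast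
  have "inj h"
  proof (subst linear_injective_0[OF lin], intro allI impI)
    fix y assume "h y = 0"
    then have "\<forall>i\<in>Basis. G x y i = 0" using hi[of _ y] by simp
    moreover have "linear (G x y)" using bilinear_G[OF assms(1)] by (simp add: bilinear_def)
    ultimately have "G x y y = 0"
      by (subst linear_eq_sum_Basis[of "G x y"]) auto
    then show "y = 0" using pos_G[OF assms(1)] by force
  qed
  then have "bij h" using linear_injective_imp_surjective[OF lin] by (simp add: bij_def)
  then obtain y where y: "h y = (\<Sum>i\<in>Basis. l i *\<^sub>R i)" "\<And>y'. h y' = h y \<Longrightarrow> y' = y"
    unfolding bij_def inj_def surj_def by metis
  have "(\<forall>i\<in>Basis. G x y' i = l i) \<longleftrightarrow> h y' = h y" for y'
    by (simp add: euclidean_eq_iff[of "h y'"] hi y(1) inner_sum_left inner_Basis if_distrib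
        cong: if_cong)
  then have "\<exists>!y. \<forall>i\<in>Basis. G x y i = l i" using y(2) by blast
  then show ?thesis unfolding eq .
qed

text \<open>The right-hand side is linear in \<open>z\<close>, so \<open>riesz\<close> applies. All
  estimates of the Christoffel symbols below go through this equation.\<close>

lemma Christoffel:
  assumes "x \<in> S"
  shows "G x (Christoffel x u w) z = (D x u w z + D x w u z - D x z u w) / 2"
proof -
  have "linear (\<lambda>z. (D x u w z + D x w u z - D x z u w) / 2)"
    by (intro linearI)
      (simp_all add: linear_add[OF linear_D1[OF assms]] linear_add[OF linear_D3[OF assms]]
        linear_cmul[OF linear_D1[OF assms]] linear_cmul[OF linear_D3[OF assms]] field_simps)
  from theI'[OF riesz[OF assms this]] show ?thesis unfolding Christoffel_def by blast
qed

lemma continuous_on_G: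
  "continuous_on (S \<times> UNIV) (\<lambda>(x, u). G x u u)"
proof -
  have "continuous_on (S \<times> UNIV) (\<lambda>q. \<Sum>i\<in>Basis. \<Sum>j\<in>Basis.
    (snd q \<bullet> i) * (snd q \<bullet> j) * G (fst q) i j)"
    by (intro continuous_intros continuous_on_compose2[OF smooth_on_continuous[OF smooth_G]]) auto
  then show ?thesis
    by (rule continuous_on_eq) (auto simp: bilinear_eq_sum_Basis[OF bilinear_G, symmetric])
qed

section \<open>Uniform estimates over a compact convex set of base points\<close>

context
  fixes K assumes K: "compact K" "convex K" "K \<subseteq> S"
begin

text \<open>On basis vectors there are finitely many smooth functions of \<open>x\<close>, which
  share a Lipschitz constant on \<open>K\<close>. Expanding each vector slot in the basis then costs
  one factor \<open>DIM('a)\<close>. The bounds for \<open>D\<close> arise in the same way with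
  three slots.\<close>

lemma G_lipschitz:
  "\<exists>C\<ge>0. \<forall>x\<in>K. \<forall>x'\<in>K. \<forall>u w. \<bar>G x u w - G x' u w\<bar> \<le> C * norm (x - x') * norm u * norm w"
proof -
  obtain C where C: "C \<ge> 0" "\<And>i j x x'. i \<in> Basis \<Longrightarrow> j \<in> Basis \<Longrightarrow> x \<in> K \<Longrightarrow> x' \<in> K \<Longrightarrow>
    \<bar>G x i j - G x' i j\<bar> \<le> C * norm (x - x')"
    using smooth_family_lipschitz[of "Basis \<times> Basis" S "\<lambda>(i, j) x. G x i j", OF _ _ K] smooth_G
    by (force simp: split_beta)
  have "\<bar>G x u w - G x' u w\<bar> \<le> (real DIM('a) * (real DIM('a) * C)) * norm (x - x') * norm u * norm w"
    if x: "x \<in> K" "x' \<in> K" for x x' u w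
  proof -
    have S: "x \<in> S" "x' \<in> S" using x K by auto
    have lin: "linear (\<lambda>u. G x u w - G x' u w)" "linear (\<lambda>w. G x u w - G x' u w)" for u w
      by (rule linearI; simp add: S G_add G_scale algebra_simps)+
    have 1: "norm (G x i w - G x' i w) \<le> real DIM('a) * (C * norm (x - x')) * norm w"
      if "i \<in> Basis" for i
      by (rule linear_norm_le_Basis[OF lin(2)]) (use x that C in auto)
    have "norm (G x u w - G x' u w) \<le>
        real DIM('a) * (real DIM('a) * (C * norm (x - x')) * norm w) * norm u"
      by (rule linear_norm_le_Basis[OF lin(1)]) (use 1 in auto)
    then show ?thesis by (simp add: mult_ac)
  qed
  then show ?thesis using C(1) by (intro exI[of _ "real DIM('a) * (real DIM('a) * C)"]) auto
qed

lemma D_bounded: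
  "\<exists>C\<ge>0. \<forall>x\<in>K. \<forall>z u w. \<bar>D x z u w\<bar> \<le> C * norm z * norm u * norm w"
proof -
  obtain C where C: "C \<ge> 0" "\<And>k i j x. k \<in> Basis \<Longrightarrow> i \<in> Basis \<Longrightarrow> j \<in> Basis \<Longrightarrow> x \<in> K \<Longrightarrow>
    \<bar>D x k i j\<bar> \<le> C"
    using smooth_family_bounded[of "Basis \<times> Basis \<times> Basis" S "\<lambda>(k, i, j) x. D x k i j", OF _ _ K(1,3)] smooth_D
    by (force simp: split_beta)
  have "\<bar>D x z u w\<bar> \<le> (real DIM('a) * (real DIM('a) * (real DIM('a) * C))) * norm z * norm u * norm w"
    if x: "x \<in> K" for x z u w
  proof -
    have S: "x \<in> S" using x K by auto
    have 1: "norm (D x k i w) \<le> real DIM('a) * C * norm w" if "i \<in> Basis" "k \<in> Basis" for i k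
      by (rule linear_norm_le_Basis[OF linear_D3[OF S]]) (use x that C in auto)
    have 2: "norm (D x k u w) \<le> real DIM('a) * (real DIM('a) * C * norm w) * norm u"
      if "k \<in> Basis" for k
      by (rule linear_norm_le_Basis[OF linear_D2[OF S]]) (use that 1 in auto)
    have "norm (D x z u w) \<le> real DIM('a) * (real DIM('a) * (real DIM('a) * C * norm w) * norm u) * norm z"
      by (rule linear_norm_le_Basis[OF linear_D1[OF S]]) (use 2 in auto)
    then show ?thesis by (simp add: mult_ac)
  qed
  then show ?thesis using C(1)
    by (intro exI[of _ "real DIM('a) * (real DIM('a) * (real DIM('a) * C))"]) auto
qed

lemma D_lipschitz:
  "\<exists>C\<ge>0. \<forall>x\<in>K. \<forall>x'\<in>K. \<forall>z u w.
    \<bar>D x z u w - D x' z u w\<bar> \<le> C * norm (x - x') * norm z * norm u * norm w"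
proof -
  obtain C where C: "C \<ge> 0" "\<And>k i j x x'. k \<in> Basis \<Longrightarrow> i \<in> Basis \<Longrightarrow> j \<in> Basis \<Longrightarrow> x \<in> K \<Longrightarrow>
    x' \<in> K \<Longrightarrow> \<bar>D x k i j - D x' k i j\<bar> \<le> C * norm (x - x')"
    using smooth_family_lipschitz[of "Basis \<times> Basis \<times> Basis" S "\<lambda>(k, i, j) x. D x k i j", OF _ _ K] smooth_D
    by (force simp: split_beta)
  have "\<bar>D x z u w - D x' z u w\<bar> \<le> (real DIM('a) * (real DIM('a) * (real DIM('a) * C))) *
      norm (x - x') * norm z * norm u * norm w"
    if x: "x \<in> K" "x' \<in> K" for x x' z u w
  proof -
    have S: "x \<in> S" "x' \<in> S" using x K by auto
    have 1: "norm (D x k i w - D x' k i w) \<le> real DIM('a) * (C * norm (x - x')) * norm w"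
      if "i \<in> Basis" "k \<in> Basis" for i k
      by (rule linear_norm_le_Basis[OF linear_compose_sub[OF linear_D3[OF S(1)] linear_D3[OF S(2)]]])
        (use x that C in auto)
    have 2: "norm (D x k u w - D x' k u w) \<le>
        real DIM('a) * (real DIM('a) * (C * norm (x - x')) * norm w) * norm u"
      if "k \<in> Basis" for k
      by (rule linear_norm_le_Basis[OF linear_compose_sub[OF linear_D2[OF S(1)] linear_D2[OF S(2)]]])
        (use that 1 in auto)
    have "norm (D x z u w - D x' z u w) \<le>
        real DIM('a) * (real DIM('a) * (real DIM('a) * (C * norm (x - x')) * norm w) * norm u) * norm z"
      by (rule linear_norm_le_Basis[OF linear_compose_sub[OF linear_D1[OF S(1)] linear_D1[OF S(2)]]])
        (use 2 in auto)
    then show ?thesis by (simp add: mult_ac)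
  qed
  then show ?thesis using C(1)
    by (intro exI[of _ "real DIM('a) * (real DIM('a) * (real DIM('a) * C))"]) auto
qed

text \<open>The minimum of the continuous function \<open>G x u u\<close> over the compact set of
  pairs with \<open>x\<close> in \<open>K\<close> and \<open>norm u = 1\<close> is positive;
  homogeneity extends the bound to all vectors.\<close>

lemma G_elliptic: "\<exists>\<mu>>0. \<forall>x\<in>K. \<forall>u. G x u u \<ge> \<mu> * (norm u)\<^sup>2"
proof (cases "K = {}")
  case True then show ?thesis by (auto intro: exI[of _ 1])
next
  case False
  have c: "compact (K \<times> sphere (0::'a) 1)" using K by (simp add: compact_Times)
  have ne: "K \<times> sphere (0::'a) 1 \<noteq> {}" using False by auto
  have "continuous_on (K \<times> sphere 0 1) (\<lambda>(x, u). G x u u)"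
    by (rule continuous_on_subset[OF continuous_on_G]) (use K in auto)
  from continuous_attains_inf[OF c ne this] obtain x0 u0 where
    0: "x0 \<in> K" "norm u0 = 1" "\<And>x u. x \<in> K \<Longrightarrow> norm u = 1 \<Longrightarrow> G x0 u0 u0 \<le> G x u u" by force
  have "G x u u \<ge> G x0 u0 u0 * (norm u)\<^sup>2" if x: "x \<in> K" for x u
  proof (cases "u = 0")
    case True then show ?thesis using x K G_nonneg by auto
  next
    case False
    have xS: "x \<in> S" using x K by auto
    have "G x (norm u *\<^sub>R sgn u) (norm u *\<^sub>R sgn u) = norm u * (norm u * G x (sgn u) (sgn u))"
      by (simp only: G_scale[OF xS])
    moreover have "norm u *\<^sub>R sgn u = u" using False by (simp add: sgn_div_norm)
    ultimately have "G x u u = (norm u)\<^sup>2 * G x (sgn u) (sgn u)"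
      by (simp only: power2_eq_square mult.assoc)
    also have "\<dots> \<ge> (norm u)\<^sup>2 * G x0 u0 u0"
      using 0(3)[OF x, of "sgn u"] False by (intro mult_left_mono) (auto simp: norm_sgn)
    finally show ?thesis by (simp only: mult.commute)
  qed
  moreover have "G x0 u0 u0 > 0" by (rule pos_G) (use 0(1,2) K(3) in auto)
  ultimately show ?thesis by blast
qed

end

text \<open>The symbols are quadratic in the velocity, so a Lipschitz bound can only hold for
  velocities in a ball, here of radius \<open>R\<close>. It is what Gronwall's inequality requires
  of the geodesic equation.\<close>

lemma Christoffel_lipschitz:
  assumes K: "compact K" "convex K" "K \<subseteq> S" and R: "R \<ge> 0"
  shows "\<exists>L\<ge>0. \<forall>x\<in>K. \<forall>x'\<in>K. \<forall>u\<in>cball 0 R. \<forall>u'\<in>cball 0 R.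
    norm (Christoffel x u u - Christoffel x' u' u') \<le> L * (norm (x - x') + norm (u - u'))"
proof -
  obtain C1 where C1: "C1 \<ge> 0"
    "\<And>x x' u w. x \<in> K \<Longrightarrow> x' \<in> K \<Longrightarrow> \<bar>G x u w - G x' u w\<bar> \<le> C1 * norm (x - x') * norm u * norm w"
    using G_lipschitz[OF K] by blast
  obtain C2 where C2: "C2 \<ge> 0"
    "\<And>x z u w. x \<in> K \<Longrightarrow> \<bar>D x z u w\<bar> \<le> C2 * norm z * norm u * norm w"
    using D_bounded[OF K] by blast
  obtain C3 where C3: "C3 \<ge> 0"
    "\<And>x x' z u w. x \<in> K \<Longrightarrow> x' \<in> K \<Longrightarrow>
      \<bar>D x z u w - D x' z u w\<bar> \<le> C3 * norm (x - x') * norm z * norm u * norm w"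
    using D_lipschitz[OF K] by blast
  obtain \<mu> where \<mu>: "\<mu> > 0" "\<And>x u. x \<in> K \<Longrightarrow> G x u u \<ge> \<mu> * (norm u)\<^sup>2"
    using G_elliptic[OF K] by blast
  \<comment> \<open>An a priori bound for the symbols, from testing the defining equation with
    \<open>z = y\<close>: the two derivative terms contribute \<open>1\<close> and
    \<open>1 / 2\<close> times \<open>C2 * R\<^sup>2 * norm y\<close>, against
    \<open>\<mu> * (norm y)\<^sup>2\<close>.\<close>
  define M where "M = (3 / 2 * C2 * R\<^sup>2) / \<mu>"
  have M0: "M \<ge> 0" unfolding M_def using C2 \<mu> by auto
  have bnd: "C * norm a * norm b * norm c \<le> C * A * B * norm c"
    if "C \<ge> 0" "norm a \<le> A" "norm b \<le> B" for C A B :: real and a b c :: 'a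
    using that by (intro mult_mono mult_nonneg_nonneg) (auto intro: order_trans[OF norm_ge_zero])
  have M: "norm (Christoffel x u u) \<le> M" if x: "x \<in> K" and u: "norm u \<le> R" for x u
    unfolding M_def
  proof (rule le_div_if_square_le[OF \<mu>(1)])
    let ?y = "Christoffel x u u"
    have "\<mu> * (norm ?y)\<^sup>2 \<le> G x ?y ?y" by (rule \<mu>(2)[OF x])
    also have "\<dots> = D x u u ?y - D x ?y u u / 2"
      using Christoffel[of x u u ?y] x K by (auto simp: field_simps)
    also have "\<dots> \<le> C2 * R * R * norm ?y + C2 * R * R * norm ?y / 2"
      using C2(2)[OF x, of u u ?y] C2(2)[OF x, of ?y u u] bnd[OF C2(1) u u, of ?y]
      by (simp add: mult_ac abs_le_iff)
    finally show "\<mu> * (norm ?y)\<^sup>2 \<le> (3 / 2 * C2 * R\<^sup>2) * norm ?y"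
      by (simp add: power2_eq_square algebra_simps)
  qed (use C2 in auto)
  have "norm (Christoffel x u u - Christoffel x' u' u') \<le>
      ((2 * C3 * R\<^sup>2 + C1 * M + 4 * C2 * R) / \<mu>) * (norm (x - x') + norm (u - u'))"
    if x: "x \<in> K" "x' \<in> K" and u: "norm u \<le> R" "norm u' \<le> R" for x x' u u'
  proof -
    have S: "x \<in> S" "x' \<in> S" using x K by auto
    define y where "y = Christoffel x u u"
    define y' where "y' = Christoffel x' u' u'"
    define z where "z = y - y'"
    define d where "d = norm (x - x')"
    define e where "e = norm (u - u')"
    have de: "d \<ge> 0" "e \<ge> 0" unfolding d_def e_def by auto
    \<comment> \<open>The Christoffel symbols are only known through the equation \<open>G x y z = D x u u z - D x z u u / 2\<close>;
      testing the difference of two such equations with \<open>z = y - y'\<close> bounds \<open>z\<close> by ellipticity.\<close>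
    have 1: "D x u u z - D x' u' u' z \<le> C3 * d * R * R * norm z + 2 * (C2 * e * R * norm z)"
    proof -
      have "D x u u z - D x' u' u' z =
          (D x u u z - D x' u u z) + D x' (u - u') u z + D x' u' (u - u') z"
        using linear_diff[OF linear_D1[OF S(2)]] linear_diff[OF linear_D2[OF S(2)]] by simp
      moreover have "D x u u z - D x' u u z \<le> C3 * d * R * R * norm z"
        using C3(2)[OF x, of u u z] bnd[of "C3 * d" u R u R z] C3(1) de u unfolding d_def by simp
      moreover have "D x' (u - u') u z \<le> C2 * e * R * norm z"
        using C2(2)[OF x(2), of "u - u'" u z] bnd[of C2 "u - u'" e u R z] C2(1) u unfolding e_def by simp
      moreover have "D x' u' (u - u') z \<le> C2 * e * R * norm z"
        using C2(2)[OF x(2), of u' "u - u'" z] bnd[of C2 "u - u'" e u' R z] C2(1) u unfolding e_def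
        by (simp add: mult_ac)
      ultimately show ?thesis by linarith
    qed
    have 2: "D x' z u' u' - D x z u u \<le> C3 * d * R * R * norm z + 2 * (C2 * e * R * norm z)"
    proof -
      have "D x' z u' u' - D x z u u =
          (D x' z u u - D x z u u) - D x' z (u - u') u - D x' z u' (u - u')"
        using linear_diff[OF linear_D2[OF S(2)]] linear_diff[OF linear_D3[OF S(2)]] by simp
      moreover have "D x' z u u - D x z u u \<le> C3 * d * R * R * norm z"
        using C3(2)[OF x, of z u u] bnd[of "C3 * d" u R u R z] C3(1) de u unfolding d_def
        by (simp add: mult_ac)
      moreover have "- D x' z (u - u') u \<le> C2 * e * R * norm z"
        using C2(2)[OF x(2), of z "u - u'" u] bnd[of C2 "u - u'" e u R z] C2(1) u unfolding e_def
        by (simp add: mult_ac)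
      moreover have "- D x' z u' (u - u') \<le> C2 * e * R * norm z"
        using C2(2)[OF x(2), of z u' "u - u'"] bnd[of C2 "u - u'" e u' R z] C2(1) u unfolding e_def
        by (simp add: mult_ac)
      ultimately show ?thesis by linarith
    qed
    have 3: "G x' y' z - G x y' z \<le> C1 * d * M * norm z"
    proof -
      have "G x' y' z - G x y' z \<le> C1 * d * norm y' * norm z"
        using C1(2)[OF x, of y' z] unfolding d_def by linarith
      also have "\<dots> \<le> C1 * d * M * norm z"
        using M[OF x(2) u(2)] C1 de unfolding y'_def by (intro mult_right_mono mult_left_mono) auto
      finally show ?thesis .
    qed
    have "\<mu> * (norm z)\<^sup>2 \<le> G x z z" by (rule \<mu>(2)[OF x(1)])
    also have "\<dots> = G x y z - G x y' z" unfolding z_def using G_diff[OF S(1)] by simp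
    \<comment> \<open>Inserting \<open>G x' y' z\<close> allows the defining equations at
      \<open>x\<close> and \<open>x'\<close> to be subtracted. The price is the last bracket, the
      change of the metric evaluated on \<open>y'\<close>; bounding it takes the a priori bound
      \<open>M\<close>.\<close>
    also have "\<dots> = (D x u u z - D x' u' u' z) + (D x' z u' u' - D x z u u) / 2 + (G x' y' z - G x y' z)"
      using Christoffel[OF S(1), of u u z] Christoffel[OF S(2), of u' u' z]
      unfolding y_def y'_def by (simp add: field_simps)
    also have "\<dots> \<le> (C3 * d * R * R * norm z + 2 * (C2 * e * R * norm z))
        + (C3 * d * R * R * norm z + 2 * (C2 * e * R * norm z)) + C1 * d * M * norm z"
    proof -
      have "0 \<le> C3 * d * R * R * norm z + 2 * (C2 * e * R * norm z)"
        using C3(1) C2(1) R de by simp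
      moreover have "a + b / 2 + c \<le> E + E + F" if "0 \<le> E" "a \<le> E" "b \<le> E" "c \<le> F" for a b c E F :: real
        using that by linarith
      ultimately show ?thesis using 1 2 3 by blast
    qed
    also have "\<dots> = ((2 * C3 * R\<^sup>2 + C1 * M) * d + 4 * C2 * R * e) * norm z"
      by (simp add: algebra_simps power2_eq_square)
    also have "\<dots> \<le> ((2 * C3 * R\<^sup>2 + C1 * M + 4 * C2 * R) * (d + e)) * norm z"
      using C1 C2 C3 R M0 de by (intro mult_right_mono) (auto simp: algebra_simps)
    finally have "norm z \<le> ((2 * C3 * R\<^sup>2 + C1 * M + 4 * C2 * R) * (d + e)) / \<mu>"
      by (rule le_div_if_square_le[OF \<mu>(1)]) (use C1 C2 C3 R M0 de in auto)
    then show ?thesis unfolding z_def y_def y'_def d_def e_def by (simp add: mult.commute)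
  qed
  then show ?thesis using C1 C2 C3 R M0 \<mu>
    by (intro exI[of _ "(2 * C3 * R\<^sup>2 + C1 * M + 4 * C2 * R) / \<mu>"]) auto
qed

text \<open>The geodesic spray: the second-order equation \<open>x'' = - \<Gamma>(x', x')\<close> as
  a vector field on pairs of position and velocity.\<close>

definition spray :: "'a \<times> 'a \<Rightarrow> 'a \<times> 'a" where
  "spray q = (snd q, - Christoffel (fst q) (snd q) (snd q))"

lemma spray_lipschitz:
  assumes K: "compact K" "convex K" "K \<subseteq> S" and R: "R \<ge> 0"
  shows "\<exists>L. L-lipschitz_on (K \<times> cball 0 R) spray"
proof -
  obtain L where L: "L \<ge> 0" "\<And>x x' u u'. x \<in> K \<Longrightarrow> x' \<in> K \<Longrightarrow> norm u \<le> R \<Longrightarrow> norm u' \<le> R \<Longrightarrow>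
    norm (Christoffel x u u - Christoffel x' u' u') \<le> L * (norm (x - x') + norm (u - u'))"
    using Christoffel_lipschitz[OF assms] by auto
  have "(1 + 2 * L)-lipschitz_on (K \<times> cball 0 R) spray"
  proof (rule lipschitz_onI)
    fix p q :: "'a \<times> 'a" assume p: "p \<in> K \<times> cball 0 R" and q: "q \<in> K \<times> cball 0 R"
    have n: "norm (fst p - fst q) \<le> dist p q" "norm (snd p - snd q) \<le> dist p q"
      using norm_fst_le[of "fst p - fst q" "snd p - snd q"] norm_snd_le[of "snd p - snd q" "fst p - fst q"]
      by (auto simp: dist_norm minus_prod_def)
    have "dist (spray p) (spray q) = norm (snd p - snd q,
        - (Christoffel (fst p) (snd p) (snd p) - Christoffel (fst q) (snd q) (snd q)))"
      by (simp add: spray_def dist_norm minus_prod_def)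
    also have "\<dots> \<le> norm (snd p - snd q) +
        norm (Christoffel (fst p) (snd p) (snd p) - Christoffel (fst q) (snd q) (snd q))"
      using norm_Pair_le by (metis norm_minus_cancel)
    also have "\<dots> \<le> dist p q + L * (norm (fst p - fst q) + norm (snd p - snd q))"
      using p q n by (intro add_mono L) auto
    also have "\<dots> \<le> dist p q + L * (dist p q + dist p q)"
      using n L(1) by (intro add_left_mono mult_left_mono) auto
    finally show "dist (spray p) (spray q) \<le> (1 + 2 * L) * dist p q" by (simp add: algebra_simps)
  qed (use L in auto)
  then show ?thesis by blast
qed

end

section \<open>Geodesics in charts\<close>

locale riemannian_manifold =
  fixes A :: "('a::{t2_space, second_countable_topology}, 'n::finite) chart set"
    and g :: "('a, 'n) metric"
  assumes atlas: "smooth_atlas A" and metric: "riemannian_metric A g"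
begin

section \<open>Charts, and the geodesic equation as a first-order system\<close>

lemma
  assumes "c \<in> A"
  shows open_chart_dom: "open (chart_dom c)"
    and open_chart_img: "open (chart_img c)"
    and continuous_on_chart_map: "continuous_on (chart_dom c) (chart_map c)"
    and continuous_on_chart_inv: "continuous_on (chart_img c) (chart_inv c)"
    and chart_inv_map: "\<And>p. p \<in> chart_dom c \<Longrightarrow> chart_inv c (chart_map c p) = p"
    and chart_map_inv: "\<And>x. x \<in> chart_img c \<Longrightarrow> chart_map c (chart_inv c x) = x"
    and chart_map_in: "\<And>p. p \<in> chart_dom c \<Longrightarrow> chart_map c p \<in> chart_img c"
    and chart_inv_in: "\<And>x. x \<in> chart_img c \<Longrightarrow> chart_inv c x \<in> chart_dom c"
proof -
  have *: "is_chart c" using atlas assms unfolding smooth_atlas_def by blast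
  then show "open (chart_dom c)" "open (chart_img c)" unfolding is_chart_def by blast+
  have h: "homeomorphism (chart_dom c) (chart_img c) (chart_map c) (chart_inv c)"
    using * unfolding is_chart_def by blast
  show "continuous_on (chart_dom c) (chart_map c)" "continuous_on (chart_img c) (chart_inv c)"
    using h by (simp_all add: homeomorphism_def)
  show "chart_inv c (chart_map c p) = p" if "p \<in> chart_dom c" for p
    by (rule homeomorphism_apply1[OF h that])
  show "chart_map c (chart_inv c x) = x" if "x \<in> chart_img c" for x
    by (rule homeomorphism_apply2[OF h that])
  show "chart_map c p \<in> chart_img c" if "p \<in> chart_dom c" for p
    using homeomorphism_image1[OF h] that by blast
  show "chart_inv c x \<in> chart_dom c" if "x \<in> chart_img c" for x
    using homeomorphism_image2[OF h] that by blast
qed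

lemma chart_inv_image:
  assumes "c \<in> A" "U \<subseteq> chart_img c"
  shows "chart_inv c ` U = {p \<in> chart_dom c. chart_map c p \<in> U}"
proof (intro equalityI subsetI)
  fix p assume "p \<in> {p \<in> chart_dom c. chart_map c p \<in> U}"
  then show "p \<in> chart_inv c ` U" using chart_inv_map[OF assms(1), of p] by (metis image_eqI mem_Collect_eq)
qed (use assms(2) chart_map_inv[OF assms(1)] chart_inv_in[OF assms(1)] in auto)

lemma open_chart_inv_image:
  assumes "c \<in> A" "open U" "U \<subseteq> chart_img c"
  shows "open (chart_inv c ` U)"
  unfolding chart_inv_image[OF assms(1,3)]
  using continuous_open_preimage[OF continuous_on_chart_map[OF assms(1)] open_chart_dom[OF assms(1)] assms(2)]
  by (simp add: vimage_def Collect_conj_eq)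

lemma open_chart_map_image:
  assumes "c \<in> A" "open U"
  shows "open (chart_map c ` (chart_dom c \<inter> U))"
proof -
  have "chart_map c ` (chart_dom c \<inter> U) = chart_img c \<inter> chart_inv c -` U"
  proof (intro equalityI subsetI)
    fix x assume "x \<in> chart_img c \<inter> chart_inv c -` U"
    then show "x \<in> chart_map c ` (chart_dom c \<inter> U)"
      using chart_map_inv[OF assms(1), of x] chart_inv_in[OF assms(1), of x]
      by (metis IntD1 IntD2 IntI image_eqI vimageE)
  qed (use chart_inv_map[OF assms(1)] chart_map_in[OF assms(1)] in auto)
  then show ?thesis
    using continuous_open_preimage[OF continuous_on_chart_inv[OF assms(1)] open_chart_img[OF assms(1)] assms(2)]
    by simp
qed

lemma closed_chart_inv_image:
  assumes "c \<in> A" "compact K" "K \<subseteq> chart_img c"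
  shows "closed (chart_inv c ` K)"
  by (intro compact_imp_closed compact_continuous_image[OF continuous_on_subset[OF
        continuous_on_chart_inv[OF assms(1)]]] assms)

lemma local_riemannian:
  assumes "c \<in> A"
  shows "local_riemannian (chart_img c) (local_metric A g c)"
  using metric assms open_chart_img[OF assms] unfolding riemannian_metric_def
  by unfold_locales auto

lemma christoffel_eq:
  assumes "c \<in> A"
  shows "christoffel A g c = local_riemannian.Christoffel (local_metric A g c)"
  by (intro ext) (simp add: christoffel_def local_riemannian.Christoffel_def[OF local_riemannian[OF assms]]
    local_riemannian.D_def[OF local_riemannian[OF assms]] local_metric_deriv_def)

text \<open>The lift of a curve to the tangent bundle, in coordinates; for a geodesic it is an
  integral curve of \<open>spray_in c\<close>. The value is meaningful only while \<gamma> is in the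
  domain of \<open>c\<close>, hence the domain conditions that accompany it.\<close>

definition state :: "('a, 'n) chart \<Rightarrow> (real \<Rightarrow> 'a) \<Rightarrow> real \<Rightarrow> (real ^ 'n) \<times> (real ^ 'n)" where
  "state c \<gamma> t = (chart_map c (\<gamma> t), velocity A UNIV \<gamma> t c)"

definition spray_in :: "('a, 'n) chart \<Rightarrow> (real ^ 'n) \<times> (real ^ 'n) \<Rightarrow> (real ^ 'n) \<times> (real ^ 'n)" where
  "spray_in c = local_riemannian.spray (local_metric A g c)"

lemma spray_in:
  "c \<in> A \<Longrightarrow> spray_in c q = (snd q, - christoffel A g c (fst q) (snd q) (snd q))"
  by (simp add: spray_in_def christoffel_eq local_riemannian.spray_def[OF local_riemannian])

lemma geodesic_continuous: "geodesic_on A g UNIV \<gamma> \<Longrightarrow> continuous_on UNIV \<gamma>"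
  by (simp add: geodesic_on_def)

lemma state_has_vector_derivative:
  assumes "geodesic_on A g UNIV \<gamma>" "c \<in> A" "\<gamma> t \<in> chart_dom c"
  shows "(state c \<gamma> has_vector_derivative spray_in c (state c \<gamma> t)) (at t)"
proof -
  have "(chart_map c \<circ> \<gamma>) differentiable (at t)"
    and v: "((\<lambda>s. velocity A UNIV \<gamma> s c) has_vector_derivative
      - christoffel A g c (chart_map c (\<gamma> t)) (velocity A UNIV \<gamma> t c) (velocity A UNIV \<gamma> t c)) (at t)"
    using assms unfolding geodesic_on_def by auto
  then have "((chart_map c \<circ> \<gamma>) has_vector_derivative velocity A UNIV \<gamma> t c) (at t)"
    using assms by (simp add: velocity_def vector_derivative_works)
  from has_vector_derivative_Pair[OF this v] show ?thesis
    using assms(2) by (simp add: state_def[abs_def] spray_in)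
qed

lemma open_in_chart_times:
  assumes "geodesic_on A g UNIV \<gamma>" "c \<in> A"
  shows "open {t. \<gamma> t \<in> chart_dom c}"
  using open_vimage[OF open_chart_dom[OF assms(2)] geodesic_continuous[OF assms(1)]]
  by (simp add: vimage_def)

lemma continuous_on_state:
  assumes "geodesic_on A g UNIV \<gamma>" "c \<in> A"
  shows "continuous_on {t. \<gamma> t \<in> chart_dom c} (state c \<gamma>)"
  using has_vector_derivative_continuous[OF state_has_vector_derivative[OF assms]]
  by (intro continuous_at_imp_continuous_on) auto

lemma open_state_times:
  assumes "geodesic_on A g UNIV \<gamma>" "c \<in> A" "open U"
  shows "open {t. \<gamma> t \<in> chart_dom c \<and> state c \<gamma> t \<in> U}"
  using continuous_open_preimage[OF continuous_on_state[OF assms(1,2)] open_in_chart_times[OF assms(1,2)] assms(3)]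
  by (simp add: vimage_def Collect_conj_eq)

text \<open>The bridge from flow lines to convexity, which is stated for geodesics on
  \<open>{a..b}\<close> with one-sided derivatives at the ends. On a nondegenerate interval the
  one-sided derivative of a differentiable curve is its derivative, so the two velocities
  agree.\<close>

lemma geodesic_on_subinterval:
  assumes \<gamma>: "geodesic_on A g UNIV \<gamma>" and ab: "a < b"
  shows "geodesic_on A g {a..b} \<gamma>"
proof -
  have vel: "velocity A {a..b} \<gamma> t c = velocity A UNIV \<gamma> t c" if t: "t \<in> {a..b}" and c: "c \<in> A" for t c
  proof (cases "\<gamma> t \<in> chart_dom c")
    case True
    then have "(chart_map c \<circ> \<gamma>) differentiable (at t)"
      using \<gamma> c unfolding geodesic_on_def by auto
    then show ?thesis
      using vector_derivative_at_within_ivl[of "chart_map c \<circ> \<gamma>" _ t a b] t ab c True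
      by (simp add: velocity_def vector_derivative_works)
  qed (simp add: velocity_def)
  show ?thesis
    unfolding geodesic_on_def
  proof (intro conjI ballI impI)
    show "continuous_on {a..b} \<gamma>" "\<gamma> ` {a..b} \<subseteq> manifold_carrier A"
      using \<gamma> continuous_on_subset unfolding geodesic_on_def by blast+
  next
    fix c t assume *: "c \<in> A" "t \<in> {a..b}" "\<gamma> t \<in> chart_dom c"
    show "(chart_map c \<circ> \<gamma>) differentiable (at t within {a..b})"
      using \<gamma> * unfolding geodesic_on_def by (auto intro: differentiable_at_withinI)
    have "((\<lambda>s. velocity A UNIV \<gamma> s c) has_vector_derivative
      - christoffel A g c (chart_map c (\<gamma> t)) (velocity A UNIV \<gamma> t c) (velocity A UNIV \<gamma> t c))
        (at t within {a..b})"
      using \<gamma> * unfolding geodesic_on_def by (auto intro: has_vector_derivative_at_within)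
    then have "((\<lambda>s. velocity A {a..b} \<gamma> s c) has_vector_derivative
      - christoffel A g c (chart_map c (\<gamma> t)) (velocity A UNIV \<gamma> t c) (velocity A UNIV \<gamma> t c))
        (at t within {a..b})"
      by (rule has_vector_derivative_transform[rotated 2]) (use * vel in auto)
    then show "((\<lambda>s. velocity A {a..b} \<gamma> s c) has_vector_derivative
      - christoffel A g c (chart_map c (\<gamma> t)) (velocity A {a..b} \<gamma> t c) (velocity A {a..b} \<gamma> t c))
        (at t within {a..b})"
      using vel * by simp
  qed
qed

lemma ex_cball_chart_img:
  assumes "c \<in> A" "x \<in> chart_img c"
  obtains r where "r > 0" "cball x r \<subseteq> chart_img c"
  using open_chart_img[OF assms(1)] assms(2) open_contains_cball by blast

lemma ex_spray_lipschitz: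
  assumes "c \<in> A" "cball x r \<subseteq> chart_img c" "R \<ge> 0"
  obtains L where "L-lipschitz_on (cball x r \<times> cball 0 R) (spray_in c)"
  using local_riemannian.spray_lipschitz[OF local_riemannian[OF assms(1)]
      compact_cball convex_cball assms(2,3)] that
  unfolding spray_in_def by blast

text \<open>Equal initial states lie in an open box \<open>U\<close> on which the spray is
  Lipschitz. Both states stay in \<open>U\<close> for a short time, where Gronwall's inequality with
  initial distance 0 forces them to coincide.\<close>

lemma geodesics_agree_locally:
  assumes \<gamma>: "geodesic_on A g UNIV \<gamma>" "geodesic_on A g UNIV \<gamma>'"
    and eq: "\<gamma> t = \<gamma>' t" "velocity A UNIV \<gamma> t = velocity A UNIV \<gamma>' t"
  shows "\<exists>\<delta>>0. \<forall>s. \<bar>s - t\<bar> < \<delta> \<longrightarrow> \<gamma> s = \<gamma>' s"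
proof -
  obtain c where c: "c \<in> A" "\<gamma> t \<in> chart_dom c"
    using \<gamma>(1) unfolding geodesic_on_def manifold_carrier_def by blast
  define x where "x = chart_map c (\<gamma> t)"
  define R where "R = norm (velocity A UNIV \<gamma> t c) + 1"
  have R: "R \<ge> 0" unfolding R_def by simp
  obtain r where r: "r > 0" "cball x r \<subseteq> chart_img c"
    using ex_cball_chart_img[OF c(1) chart_map_in[OF c]] unfolding x_def by blast
  obtain L where L: "L-lipschitz_on (cball x r \<times> cball 0 R) (spray_in c)"
    by (rule ex_spray_lipschitz[OF c(1) r(2) R])
  define U where "U = ball x r \<times> ball (0::real^'n) R"
  have U: "open U" unfolding U_def by (simp add: open_Times)
  have st: "state c \<gamma> t = state c \<gamma>' t" using eq by (simp add: state_def)
  have "state c \<gamma> t \<in> U" using r unfolding state_def U_def R_def x_def by simp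
  then have "open ({t. \<gamma> t \<in> chart_dom c \<and> state c \<gamma> t \<in> U} \<inter> {t. \<gamma>' t \<in> chart_dom c \<and> state c \<gamma>' t \<in> U})"
    "t \<in> {t. \<gamma> t \<in> chart_dom c \<and> state c \<gamma> t \<in> U} \<inter> {t. \<gamma>' t \<in> chart_dom c \<and> state c \<gamma>' t \<in> U}"
    using open_state_times[OF \<gamma>(1) c(1) U] open_state_times[OF \<gamma>(2) c(1) U] c(2) eq(1) st by auto
  then obtain \<delta> where \<delta>: "\<delta> > 0" "\<And>s. dist s t < \<delta> \<Longrightarrow> \<gamma> s \<in> chart_dom c \<and> state c \<gamma> s \<in> U \<and>
      \<gamma>' s \<in> chart_dom c \<and> state c \<gamma>' s \<in> U"
    unfolding open_dist by blast
  have UK: "U \<subseteq> cball x r \<times> cball 0 R" unfolding U_def by auto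
  have "\<gamma> s = \<gamma>' s" if s: "\<bar>s - t\<bar> < \<delta>" for s
  proof -
    \<comment> \<open>Gronwall's inequality runs forward from time 0. The sign \<sigma> reflects
      time when \<open>s < t\<close>; the reflected field
      \<open>\<sigma> *\<^sub>R spray_in c q\<close> keeps the Lipschitz constant
      \<open>L\<close>.\<close>
    have "\<exists>\<sigma>. \<bar>\<sigma>\<bar> = (1::real) \<and> s = t + \<sigma> * \<bar>s - t\<bar>"
      by (cases "s \<ge> t") (auto intro: exI[of _ 1] exI[of _ "-1"])
    then obtain \<sigma> :: real where \<sigma>: "\<bar>\<sigma>\<bar> = 1" "s = t + \<sigma> * \<bar>s - t\<bar>" by blast
    let ?T = "\<bar>s - t\<bar>"
    have near: "dist (t + \<sigma> * \<tau>) t < \<delta>" if "\<tau> \<in> {0..?T}" for \<tau>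
      using that s \<sigma>(1) by (auto simp: dist_real_def abs_mult)
    have der: "((\<lambda>\<tau>. state c \<beta> (t + \<sigma> * \<tau>)) has_vector_derivative
        \<sigma> *\<^sub>R spray_in c (state c \<beta> (t + \<sigma> * \<tau>))) (at \<tau>)"
      if "geodesic_on A g UNIV \<beta>" "\<beta> (t + \<sigma> * \<tau>) \<in> chart_dom c" for \<beta> \<tau>
    proof -
      have "((\<lambda>\<tau>. t + \<sigma> * \<tau>) has_vector_derivative \<sigma>) (at \<tau>)"
        by (auto intro!: derivative_eq_intros simp: has_vector_derivative_def)
      from vector_diff_chain_at[OF this state_has_vector_derivative[OF that(1) c(1) that(2)]]
      show ?thesis by (simp add: o_def)
    qed
    have lip: "L-lipschitz_on (cball x r \<times> cball 0 R) (\<lambda>q. \<sigma> *\<^sub>R spray_in c q)"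
      using lipschitz_on_cmult[OF L, of \<sigma>] \<sigma>(1) by simp
    have "norm (state c \<gamma> (t + \<sigma> * ?T) - state c \<gamma>' (t + \<sigma> * ?T)) \<le>
        exp (L * ?T) * norm (state c \<gamma> (t + \<sigma> * 0) - state c \<gamma>' (t + \<sigma> * 0))"
      by (rule gronwall_lipschitz[OF lip, where X = "\<lambda>\<tau>. state c \<gamma> (t + \<sigma> * \<tau>)"
            and Y = "\<lambda>\<tau>. state c \<gamma>' (t + \<sigma> * \<tau>)"])
        (simp, (use der[OF \<gamma>(1)] der[OF \<gamma>(2)] \<delta>(2)[OF near] UK in blast)+)
    then have "norm (state c \<gamma> s - state c \<gamma>' s) \<le> 0"
      unfolding \<sigma>(2)[symmetric] using st by simp
    then have "state c \<gamma> s = state c \<gamma>' s" by simp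
    then have "chart_map c (\<gamma> s) = chart_map c (\<gamma>' s)" by (simp add: state_def)
    then show ?thesis
      using chart_inv_map[OF c(1)] \<delta>(2)[of s] s by (metis dist_real_def)
  qed
  then show ?thesis using \<delta>(1) by blast
qed

lemma velocity_cong_local:
  assumes "\<delta> > 0" "\<And>s. \<bar>s - t\<bar> < \<delta> \<Longrightarrow> \<gamma> s = \<gamma>' s"
  shows "velocity A UNIV \<gamma> t = velocity A UNIV \<gamma>' t"
proof -
  have "\<forall>\<^sub>F s in nhds t. \<gamma> s = \<gamma>' s"
    unfolding eventually_nhds_metric dist_real_def using assms by blast
  then have "vector_derivative (chart_map c \<circ> \<gamma>) (at t) = vector_derivative (chart_map c \<circ> \<gamma>') (at t)"
    for c :: "('a, 'n) chart"
    by (intro vector_derivative_cong_eq) (auto elim: eventually_mono)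
  moreover have "\<gamma> t = \<gamma>' t" using assms by simp
  ultimately show ?thesis by (simp add: velocity_def cong: if_cong)
qed

text \<open>The times at which position and velocity agree form a set that is open by local
  uniqueness, closed by continuity (positions have unique limits in a Hausdorff space) and nonempty,
  hence all of the connected real line.\<close>

lemma geodesic_unique:
  assumes \<gamma>: "geodesic_on A g UNIV \<gamma>" "geodesic_on A g UNIV \<gamma>'"
    and eq: "\<gamma> t0 = \<gamma>' t0" "velocity A UNIV \<gamma> t0 = velocity A UNIV \<gamma>' t0"
  shows "\<gamma> = \<gamma>'"
proof -
  define E where "E = {t. \<gamma> t = \<gamma>' t \<and> velocity A UNIV \<gamma> t = velocity A UNIV \<gamma>' t}"
  have "open E"
    unfolding open_dist
  proof
    fix t assume "t \<in> E"
    then obtain \<delta> where \<delta>: "\<delta> > 0" "\<And>s. \<bar>s - t\<bar> < \<delta> \<Longrightarrow> \<gamma> s = \<gamma>' s"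
      using geodesics_agree_locally[OF \<gamma>] unfolding E_def by blast
    have "s \<in> E" if "dist s t < \<delta>" for s
    proof -
      have "\<gamma> s' = \<gamma>' s'" if "\<bar>s' - s\<bar> < \<delta> - dist s t" for s'
        using that by (intro \<delta>) (auto simp: dist_real_def)
      then show ?thesis
        using velocity_cong_local[of "\<delta> - dist s t" s \<gamma> \<gamma>'] \<open>dist s t < \<delta>\<close> unfolding E_def by simp
    qed
    then show "\<exists>e>0. \<forall>s. dist s t < e \<longrightarrow> s \<in> E" using \<delta>(1) by blast
  qed
  moreover have "closed E"
    unfolding closed_sequential_limits
  proof (intro allI impI)
    fix s t assume "(\<forall>n. s n \<in> E) \<and> s \<longlonglongrightarrow> t"
    then have s: "\<And>n. s n \<in> E" "s \<longlonglongrightarrow> t" by auto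
    have "(\<lambda>n. \<gamma> (s n)) \<longlonglongrightarrow> \<gamma> t" "(\<lambda>n. \<gamma>' (s n)) \<longlonglongrightarrow> \<gamma>' t"
      using continuous_on_tendsto_compose[OF geodesic_continuous s(2)] \<gamma> by auto
    moreover have "(\<lambda>n. \<gamma> (s n)) = (\<lambda>n. \<gamma>' (s n))" using s(1) by (simp add: E_def)
    ultimately have gt: "\<gamma> t = \<gamma>' t" by (metis LIMSEQ_unique)
    \<comment> \<open>A velocity is a family indexed by charts. Around the limit point its
      components agree by continuity of \<open>state\<close>; for all other charts both components
      are the default value 0.\<close>
    have "velocity A UNIV \<gamma> t c = velocity A UNIV \<gamma>' t c" for c
    proof (cases "c \<in> A \<and> \<gamma> t \<in> chart_dom c")
      case True
      have "isCont (state c \<beta>) t" if "geodesic_on A g UNIV \<beta>" "\<beta> t \<in> chart_dom c" for \<beta>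
        using True by (intro has_vector_derivative_continuous[OF state_has_vector_derivative[OF that(1) _ that(2)]]) simp
      then have "(\<lambda>n. snd (state c \<gamma> (s n))) \<longlonglongrightarrow> snd (state c \<gamma> t)"
          "(\<lambda>n. snd (state c \<gamma>' (s n))) \<longlonglongrightarrow> snd (state c \<gamma>' t)"
        using \<gamma> True gt by (auto intro!: tendsto_snd isCont_tendsto_compose[OF _ s(2)])
      moreover have "(\<lambda>n. snd (state c \<gamma> (s n))) = (\<lambda>n. snd (state c \<gamma>' (s n)))"
        using s(1) by (simp add: E_def state_def)
      ultimately show ?thesis by (metis LIMSEQ_unique snd_conv state_def)
    qed (use gt in \<open>auto simp: velocity_def\<close>)
    then show "t \<in> E" using gt unfolding E_def by blast
  qed
  moreover have "t0 \<in> E" using eq unfolding E_def by simp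
  ultimately have E: "E = UNIV"
    using clopen[of E] by blast
  show ?thesis
  proof
    show "\<gamma> t = \<gamma>' t" for t using UNIV_I[of t, folded E] by (simp add: E_def)
  qed
qed

text \<open>Completeness supplies a geodesic and \<open>geodesic_unique\<close> at time 0 makes it
  the only one, so the definite description denotes it.\<close>

lemma the_geodesic:
  assumes "geodesically_complete A g" "\<theta> \<in> tangent_bundle A"
  shows "geodesic_on A g UNIV (the_geodesic A g \<theta>)"
    and "the_geodesic A g \<theta> 0 = fst \<theta>"
    and "velocity A UNIV (the_geodesic A g \<theta>) 0 = snd \<theta>"
proof -
  have "\<exists>\<gamma>. geodesic_on A g UNIV \<gamma> \<and> \<gamma> 0 = fst \<theta> \<and> velocity A UNIV \<gamma> 0 = snd \<theta>"
    using assms unfolding geodesically_complete_def by (cases \<theta>) auto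
  moreover have "\<gamma> = \<gamma>'" if "geodesic_on A g UNIV \<gamma> \<and> \<gamma> 0 = fst \<theta> \<and> velocity A UNIV \<gamma> 0 = snd \<theta>"
    "geodesic_on A g UNIV \<gamma>' \<and> \<gamma>' 0 = fst \<theta> \<and> velocity A UNIV \<gamma>' 0 = snd \<theta>" for \<gamma> \<gamma>'
    by (rule geodesic_unique[of _ _ 0]) (use that in auto)
  ultimately have "\<exists>!\<gamma>. geodesic_on A g UNIV \<gamma> \<and> \<gamma> 0 = fst \<theta> \<and> velocity A UNIV \<gamma> 0 = snd \<theta>"
    by (rule ex_ex1I)
  from theI'[OF this, folded the_geodesic_def]
  show "geodesic_on A g UNIV (the_geodesic A g \<theta>)" "the_geodesic A g \<theta> 0 = fst \<theta>"
    "velocity A UNIV (the_geodesic A g \<theta>) 0 = snd \<theta>" by blast+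
qed

text \<open>While the state is in the box its speed is at most \<open>C\<close>, so within time
  \<epsilon> it moves by at most \<open>C * \<epsilon>\<close>. This is less than the margin left by
  the initial conditions, \<open>r / 2\<close> in position and 1 in velocity, so there is no first
  exit.\<close>

lemma geodesic_confined:
  assumes \<gamma>: "geodesic_on A g UNIV \<gamma>" and c: "c \<in> A" "\<gamma> 0 \<in> chart_dom c"
    and r: "r > 0" "cball x r \<subseteq> chart_img c" and R: "R \<ge> 0"
    and bound: "\<And>q. q \<in> cball x r \<times> cball 0 (R + 1) \<Longrightarrow> norm (spray_in c q) \<le> C"
    and \<epsilon>: "C * \<epsilon> < r / 2" "C * \<epsilon> < 1"
    and init: "dist x (chart_map c (\<gamma> 0)) \<le> r / 2" "norm (velocity A UNIV \<gamma> 0 c) \<le> R"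
    and t: "t \<in> {0..\<epsilon>}"
  shows "\<gamma> t \<in> chart_dom c" "state c \<gamma> t \<in> cball x r \<times> cball 0 (R + 1)"
proof -
  define U where "U = ball x r \<times> ball (0::real^'n) (R + 1)"
  have UK: "U \<subseteq> cball x r \<times> cball 0 (R + 1)" unfolding U_def by auto
  define P where "P = {t. \<gamma> t \<in> chart_dom c \<and> state c \<gamma> t \<in> U}"
  have "open P" unfolding P_def U_def by (intro open_state_times[OF \<gamma> c(1)] open_Times open_ball)
  have C: "C \<ge> 0" by (rule order_trans[OF norm_ge_zero bound[of "(x, 0)"]]) (use r R in auto)
  have "0 \<in> P" using c init r R unfolding P_def U_def state_def by auto
  have "{0..\<epsilon>} \<subseteq> P"
  proof (rule ccontr)
    assume "\<not> {0..\<epsilon>} \<subseteq> P"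
    then have "compact ({0..\<epsilon>} - P)" "{0..\<epsilon>} - P \<noteq> {}"
      using \<open>open P\<close> by (auto intro: compact_diff)
    from compact_attains_inf[OF this] obtain T where
      T: "T \<in> {0..\<epsilon>}" "T \<notin> P" and min: "\<And>s. s \<in> {0..\<epsilon>} - P \<Longrightarrow> T \<le> s" by blast
    have T0: "T > 0" using T \<open>0 \<in> P\<close> by (cases "T = 0") auto
    have below: "s \<in> P" if "0 \<le> s" "s < T" for s
      using min[of s] that T(1) by force
    \<comment> \<open>\<open>T\<close> is the exit time.  Compact sets are closed in the Hausdorff space \<open>M\<close>, so at time \<open>T\<close>
      the geodesic has not yet left the chart domain.\<close>
    have "closed (\<gamma> -` chart_inv c ` cball x r)"
      by (rule closed_vimage[OF closed_chart_inv_image[OF c(1) compact_cball r(2)] geodesic_continuous[OF \<gamma>]])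
    moreover have "{0..<T} \<subseteq> \<gamma> -` chart_inv c ` cball x r"
    proof
      fix s assume "s \<in> {0..<T}"
      then have "\<gamma> s \<in> chart_dom c" "chart_map c (\<gamma> s) \<in> cball x r"
        using below[of s] by (auto simp: P_def U_def state_def)
      then show "s \<in> \<gamma> -` chart_inv c ` cball x r"
        unfolding chart_inv_image[OF c(1) r(2)] by simp
    qed
    ultimately have "closure {0..<T} \<subseteq> \<gamma> -` chart_inv c ` cball x r" by (rule closure_minimal[rotated])
    moreover have "T \<in> closure {0..<T}" using T0 by simp
    ultimately have "\<gamma> T \<in> chart_dom c"
      unfolding chart_inv_image[OF c(1) r(2)] by blast
    then have dom: "\<gamma> s \<in> chart_dom c" if "0 \<le> s" "s \<le> T" for s
      using below[of s] that by (cases "s = T") (auto simp: P_def)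
    have "norm (state c \<gamma> T - state c \<gamma> 0) \<le> C * T - C * 0"
    proof (rule differentiable_bound_general[OF T0])
      show "continuous_on {0..T} (state c \<gamma>)"
        by (rule continuous_on_subset[OF continuous_on_state[OF \<gamma> c(1)]]) (use dom in auto)
      show "continuous_on {0..T} ((*) C)" by (intro continuous_intros)
      show "(state c \<gamma> has_vector_derivative spray_in c (state c \<gamma> s)) (at s)" if "0 < s" "s < T" for s
        by (rule state_has_vector_derivative[OF \<gamma> c(1)]) (use dom that in auto)
      show "((*) C has_vector_derivative C) (at s)" for s
        by (auto intro!: derivative_eq_intros simp: has_vector_derivative_def)
      show "norm (spray_in c (state c \<gamma> s)) \<le> C" if "0 < s" "s < T" for s
        using below[of s] that UK by (intro bound) (auto simp: P_def)
    qed
    also have "\<dots> \<le> C * \<epsilon>" using T(1) C by (simp add: mult_left_mono)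
    finally have move: "norm (state c \<gamma> T - state c \<gamma> 0) \<le> C * \<epsilon>" .
    have "dist x (chart_map c (\<gamma> T)) \<le> dist x (chart_map c (\<gamma> 0)) + norm (chart_map c (\<gamma> T) - chart_map c (\<gamma> 0))"
      by (metis dist_norm dist_commute dist_triangle)
    moreover have "norm (chart_map c (\<gamma> T) - chart_map c (\<gamma> 0)) \<le> norm (state c \<gamma> T - state c \<gamma> 0)"
      using norm_fst_le by (simp add: state_def)
    moreover have "norm (velocity A UNIV \<gamma> T c) \<le> norm (velocity A UNIV \<gamma> 0 c) +
        norm (velocity A UNIV \<gamma> T c - velocity A UNIV \<gamma> 0 c)"
      by (metis add.commute diff_add_cancel norm_triangle_ineq)
    moreover have "norm (velocity A UNIV \<gamma> T c - velocity A UNIV \<gamma> 0 c) \<le> norm (state c \<gamma> T - state c \<gamma> 0)"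
      using norm_snd_le by (simp add: state_def)
    ultimately have "state c \<gamma> T \<in> U"
      using move init \<epsilon> unfolding U_def state_def by simp
    then show False using T(2) \<open>\<gamma> T \<in> chart_dom c\<close> by (simp add: P_def)
  qed
  then have "t \<in> P" using t by blast
  then show "\<gamma> t \<in> chart_dom c" "state c \<gamma> t \<in> cball x r \<times> cball 0 (R + 1)"
    using UK by (auto simp: P_def)
qed

text \<open>All constants depend on \<open>x\<close> and \<open>R\<close> only, not on the geodesic.
  The first estimate is Taylor's formula for a curve with bounded second derivative, the second is
  continuous dependence on the initial state. The radius obtained is half of one that fits into the
  chart, which leaves the margin required by \<open>geodesic_confined\<close>.\<close>

lemma short_geodesics:
  assumes c: "c \<in> A" and x: "x \<in> chart_img c" and R: "R \<ge> 0"
  obtains r \<epsilon> C M where "r > 0" "\<epsilon> > 0" "C \<ge> 0" "M \<ge> 0" "cball x r \<subseteq> chart_img c"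
    and "\<And>\<gamma> t. geodesic_on A g UNIV \<gamma> \<Longrightarrow> \<gamma> 0 \<in> chart_dom c \<Longrightarrow>
      dist x (chart_map c (\<gamma> 0)) \<le> r \<Longrightarrow> norm (velocity A UNIV \<gamma> 0 c) \<le> R \<Longrightarrow> t \<in> {0..\<epsilon>} \<Longrightarrow>
      \<gamma> t \<in> chart_dom c \<and>
      norm (chart_map c (\<gamma> t) - chart_map c (\<gamma> 0) - t *\<^sub>R velocity A UNIV \<gamma> 0 c) \<le> C * t\<^sup>2"
    and "\<And>\<gamma> \<gamma>' t. geodesic_on A g UNIV \<gamma> \<Longrightarrow> \<gamma> 0 \<in> chart_dom c \<Longrightarrow>
      dist x (chart_map c (\<gamma> 0)) \<le> r \<Longrightarrow> norm (velocity A UNIV \<gamma> 0 c) \<le> R \<Longrightarrow>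
      geodesic_on A g UNIV \<gamma>' \<Longrightarrow> \<gamma>' 0 \<in> chart_dom c \<Longrightarrow>
      dist x (chart_map c (\<gamma>' 0)) \<le> r \<Longrightarrow> norm (velocity A UNIV \<gamma>' 0 c) \<le> R \<Longrightarrow> t \<in> {0..\<epsilon>} \<Longrightarrow>
      norm (chart_map c (\<gamma> t) - chart_map c (\<gamma>' t)) \<le> M * norm (state c \<gamma> 0 - state c \<gamma>' 0)"
proof -
  obtain r where r: "r > 0" "cball x r \<subseteq> chart_img c" by (rule ex_cball_chart_img[OF c x])
  define K where "K = cball x r \<times> cball (0::real^'n) (R + 1)"
  obtain L where L: "L-lipschitz_on K (spray_in c)"
    unfolding K_def by (rule ex_spray_lipschitz[OF c r(2), of "R + 1"]) (use R in auto)
  have "compact (spray_in c ` K)"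
    unfolding K_def by (rule compact_continuous_image[OF lipschitz_on_continuous_on[OF L[unfolded K_def]]])
      (simp add: compact_Times)
  then obtain C where C: "C > 0" "\<And>q. q \<in> K \<Longrightarrow> norm (spray_in c q) \<le> C"
    using compact_imp_bounded bounded_pos by (metis imageI)
  \<comment> \<open>Makes \<open>C * \<epsilon>\<close> half of the smaller of the two margins
    \<open>r / 2\<close> and 1.\<close>
  define \<epsilon> where "\<epsilon> = min (r / 2) 1 / (2 * C)"
  have \<epsilon>: "\<epsilon> > 0" "C * \<epsilon> < r / 2" "C * \<epsilon> < 1" using C(1) r(1) unfolding \<epsilon>_def by (auto simp: min_def)
  have conf: "\<gamma> t \<in> chart_dom c" "state c \<gamma> t \<in> K"
    if "geodesic_on A g UNIV \<gamma>" "\<gamma> 0 \<in> chart_dom c" "dist x (chart_map c (\<gamma> 0)) \<le> r / 2"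
      "norm (velocity A UNIV \<gamma> 0 c) \<le> R" "t \<in> {0..\<epsilon>}" for \<gamma> t
    unfolding K_def
    using geodesic_confined[OF that(1) c that(2) r R C(2)[unfolded K_def] \<epsilon>(2,3) that(3-5)] by blast+
  have der: "(state c \<gamma> has_vector_derivative spray_in c (state c \<gamma> t)) (at t)"
    if "geodesic_on A g UNIV \<gamma>" "\<gamma> 0 \<in> chart_dom c" "dist x (chart_map c (\<gamma> 0)) \<le> r / 2"
      "norm (velocity A UNIV \<gamma> 0 c) \<le> R" "t \<in> {0..\<epsilon>}" for \<gamma> t
    by (rule state_has_vector_derivative[OF that(1) c conf(1)[OF that]])
  have quad: "norm (chart_map c (\<gamma> t) - chart_map c (\<gamma> 0) - t *\<^sub>R velocity A UNIV \<gamma> 0 c) \<le> C * t\<^sup>2"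
    if \<gamma>: "geodesic_on A g UNIV \<gamma>" "\<gamma> 0 \<in> chart_dom c" "dist x (chart_map c (\<gamma> 0)) \<le> r / 2"
      "norm (velocity A UNIV \<gamma> 0 c) \<le> R" and t: "t \<in> {0..\<epsilon>}" for \<gamma> t
  proof (cases "t = 0")
    case False
    then have t0: "t > 0" using t by auto
    define S where "S = state c \<gamma>"
    have S: "(S has_vector_derivative spray_in c (S s)) (at s)" "norm (spray_in c (S s)) \<le> C"
      if "0 \<le> s" "s \<le> t" for s
      using der[OF \<gamma>, of s] C(2)[OF conf(2)[OF \<gamma>, of s]] that t by (auto simp: S_def)
    have Sc: "continuous_on {0..s} S" if "s \<le> t" for s
      using has_vector_derivative_continuous[OF S(1)] that by (intro continuous_at_imp_continuous_on) auto
    \<comment> \<open>First integration: the bound on the spray limits the drift of the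
      velocity.\<close>
    have vel: "norm (snd (S s) - snd (S 0)) \<le> C * t" if "0 < s" "s < t" for s
    proof -
      have "norm (S s - S 0) \<le> C * s - C * 0"
      proof (rule differentiable_bound_general[OF that(1)])
        show "continuous_on {0..s} S" using Sc that by simp
        show "continuous_on {0..s} ((*) C)" by (intro continuous_intros)
        show "(S has_vector_derivative spray_in c (S \<tau>)) (at \<tau>)" "norm (spray_in c (S \<tau>)) \<le> C"
          if "0 < \<tau>" "\<tau> < s" for \<tau>
          using S[of \<tau>] that \<open>s < t\<close> by auto
        show "((*) C has_vector_derivative C) (at s)" for s
          by (auto intro!: derivative_eq_intros simp: has_vector_derivative_def)
      qed
      also have "\<dots> \<le> C * t" using \<open>s < t\<close> C(1) by simp
      finally have "norm (S s - S 0) \<le> C * t" .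
      moreover have "norm (snd (S s) - snd (S 0)) \<le> norm (S s - S 0)"
        using norm_snd_le[of "snd (S s - S 0)" "fst (S s - S 0)"] unfolding prod.collapse by simp
      ultimately show ?thesis by linarith
    qed
    \<comment> \<open>Second integration: with the linear part subtracted, the derivative is exactly
      the drift of the velocity. Bounding the drift by its final bound \<open>C * t\<close> gives
      the constant \<open>C\<close> in place of the sharp \<open>C / 2\<close>.\<close>
    let ?h = "\<lambda>s. fst (S s) - s *\<^sub>R snd (S 0)"
    have "norm (?h t - ?h 0) \<le> (C * t) * t - (C * t) * 0"
    proof (rule differentiable_bound_general[OF t0])
      show "continuous_on {0..t} ?h" by (intro continuous_intros Sc) simp
      show "continuous_on {0..t} ((*) (C * t))" by (intro continuous_intros)
      show "((*) (C * t) has_vector_derivative C * t) (at s)" for s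
        by (auto intro!: derivative_eq_intros simp: has_vector_derivative_def)
      show "(?h has_vector_derivative snd (S s) - snd (S 0)) (at s)" if "0 < s" "s < t" for s
      proof -
        have "((\<lambda>s. fst (S s)) has_vector_derivative fst (spray_in c (S s))) (at s)"
          using S(1)[of s] that by (auto simp: has_vector_derivative_def dest: has_derivative_fst)
        then have "((\<lambda>s. fst (S s)) has_vector_derivative snd (S s)) (at s)"
          by (simp add: spray_in[OF c])
        then show ?thesis by (auto intro!: derivative_eq_intros has_vector_derivative_diff)
      qed
      show "norm (snd (S s) - snd (S 0)) \<le> C * t" if "0 < s" "s < t" for s using vel[OF that] .
    qed
    then show ?thesis
      by (simp add: S_def state_def power2_eq_square mult.assoc algebra_simps)
  qed simp
  have gron: "norm (chart_map c (\<gamma> t) - chart_map c (\<gamma>' t)) \<le>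
      exp (L * \<epsilon>) * norm (state c \<gamma> 0 - state c \<gamma>' 0)"
    if \<gamma>: "geodesic_on A g UNIV \<gamma>" "\<gamma> 0 \<in> chart_dom c" "dist x (chart_map c (\<gamma> 0)) \<le> r / 2"
      "norm (velocity A UNIV \<gamma> 0 c) \<le> R"
    and \<gamma>': "geodesic_on A g UNIV \<gamma>'" "\<gamma>' 0 \<in> chart_dom c" "dist x (chart_map c (\<gamma>' 0)) \<le> r / 2"
      "norm (velocity A UNIV \<gamma>' 0 c) \<le> R" and t: "t \<in> {0..\<epsilon>}" for \<gamma> \<gamma>' t
  proof -
    have sub: "s \<in> {0..\<epsilon>}" if "s \<in> {0..t}" for s using that t by auto
    have "norm (chart_map c (\<gamma> t) - chart_map c (\<gamma>' t)) \<le> norm (state c \<gamma> t - state c \<gamma>' t)"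
      using norm_fst_le by (simp add: state_def)
    also have "\<dots> \<le> exp (L * t) * norm (state c \<gamma> 0 - state c \<gamma>' 0)"
      by (rule gronwall_lipschitz[OF L])
        (use t in simp, (use der[OF \<gamma> sub] der[OF \<gamma>' sub] conf(2)[OF \<gamma> sub] conf(2)[OF \<gamma>' sub] in blast)+)
    also have "\<dots> \<le> exp (L * \<epsilon>) * norm (state c \<gamma> 0 - state c \<gamma>' 0)"
      using t lipschitz_on_nonneg[OF L] by (intro mult_right_mono) (auto intro: mult_left_mono)
    finally show ?thesis .
  qed
  have half: "cball x (r / 2) \<subseteq> chart_img c"
    by (rule order_trans[OF subset_cball r(2)]) (use r(1) in simp)
  show ?thesis
  proof (rule that[of "r / 2" \<epsilon> C "exp (L * \<epsilon>)"])
    show "r / 2 > 0" "C \<ge> 0" using r C by simp_all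
    show "\<gamma> t \<in> chart_dom c \<and>
        norm (chart_map c (\<gamma> t) - chart_map c (\<gamma> 0) - t *\<^sub>R velocity A UNIV \<gamma> 0 c) \<le> C * t\<^sup>2"
      if "geodesic_on A g UNIV \<gamma>" "\<gamma> 0 \<in> chart_dom c" "dist x (chart_map c (\<gamma> 0)) \<le> r / 2"
        "norm (velocity A UNIV \<gamma> 0 c) \<le> R" "t \<in> {0..\<epsilon>}" for \<gamma> t
      using conf(1)[OF that] quad[OF that] by blast
  qed (rule \<epsilon>(1) half gron exp_ge_zero | assumption)+
qed

subsection \<open>The Liouville measure of open sets\<close>

lemma transition_smooth:
  "c \<in> A \<Longrightarrow> d \<in> A \<Longrightarrow> smooth_on (chart_map c ` (chart_dom c \<inter> chart_dom d)) (chart_map d \<circ> chart_inv c)"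
  using atlas unfolding smooth_atlas_def by blast

lemma transition_has_derivative:
  assumes "c \<in> A" "d \<in> A" "p \<in> chart_dom c" "p \<in> chart_dom d"
  shows "((chart_map d \<circ> chart_inv c) has_derivative transition_deriv c d p) (at (chart_map c p))"
  unfolding transition_deriv_def
  by (rule smooth_on_has_derivative[OF transition_smooth[OF assms(1,2)]]) (use assms in blast)

text \<open>The chain rule. The composite through \<open>d\<close> equals the direct transition map
  only on the overlap with \<open>d\<close>, but that set is open and derivatives are local.\<close>

lemma transition_deriv_compose:
  assumes c: "c \<in> A" and d: "d \<in> A" and e: "e \<in> A"
    and p: "p \<in> chart_dom c" "p \<in> chart_dom d" "p \<in> chart_dom e"
  shows "transition_deriv c e p u = transition_deriv d e p (transition_deriv c d p u)"
proof -
  let ?T = "chart_map c ` (chart_dom c \<inter> chart_dom d)"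
  have "((chart_map e \<circ> chart_inv d) has_derivative transition_deriv d e p)
      (at ((chart_map d \<circ> chart_inv c) (chart_map c p)))"
    using transition_has_derivative[OF d e p(2,3)] chart_inv_map[OF c p(1)] by simp
  from diff_chain_at[OF transition_has_derivative[OF c d p(1,2)] this]
  have "((chart_map e \<circ> chart_inv d \<circ> (chart_map d \<circ> chart_inv c)) has_derivative
    (transition_deriv d e p \<circ> transition_deriv c d p)) (at (chart_map c p))" .
  then have "((chart_map e \<circ> chart_inv c) has_derivative
    (transition_deriv d e p \<circ> transition_deriv c d p)) (at (chart_map c p))"
  proof (rule has_derivative_transform_within_open)
    show "open ?T" by (rule open_chart_map_image[OF c open_chart_dom[OF d]])
    show "chart_map c p \<in> ?T" using p by blast
    show "(chart_map e \<circ> chart_inv d \<circ> (chart_map d \<circ> chart_inv c)) x = (chart_map e \<circ> chart_inv c) x"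
      if "x \<in> ?T" for x
      using that by (auto simp: chart_inv_map[OF c] chart_inv_map[OF d])
  qed
  from has_derivative_unique[OF this transition_has_derivative[OF c e p(1,3)]]
  show ?thesis by (metis comp_apply)
qed

lemma transition_deriv_self:
  assumes "c \<in> A" "p \<in> chart_dom c"
  shows "transition_deriv c c p u = u"
proof -
  have "((chart_map c \<circ> chart_inv c) has_derivative (\<lambda>u. u)) (at (chart_map c p))"
    by (rule has_derivative_transform_within_open[OF has_derivative_ident open_chart_img[OF assms(1)]
          chart_map_in[OF assms]]) (simp add: chart_map_inv[OF assms(1)])
  from has_derivative_unique[OF this transition_has_derivative[OF assms(1,1,2,2)]]
  show ?thesis by metis
qed

text \<open>The cocycle property \<open>transition_deriv_compose\<close> makes the family of
  transformed coordinate vectors compatible. Together with \<open>tangent_of_component\<close> this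
  makes \<open>tangent_of A c p\<close> and evaluation at \<open>c\<close> mutually inverse.\<close>

lemma tangent_of_in:
  assumes "c \<in> A" "p \<in> chart_dom c"
  shows "tangent_of A c p u \<in> tangent_space A p" and "tangent_of A c p u c = u"
proof -
  have "tangent_of A c p u e = transition_deriv d e p (tangent_of A c p u d)"
    if "d \<in> A" "e \<in> A" "p \<in> chart_dom d \<inter> chart_dom e" for d e
    using that transition_deriv_compose[OF assms(1) that(1,2) assms(2)] by (simp add: tangent_of_def)
  moreover have "tangent_of A c p u d = 0" if "d \<notin> A \<or> p \<notin> chart_dom d" for d
    using that by (auto simp: tangent_of_def)
  ultimately show "tangent_of A c p u \<in> tangent_space A p"
    unfolding tangent_space_def by blast
  show "tangent_of A c p u c = u"
    using assms by (simp add: tangent_of_def transition_deriv_self)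
qed

lemma tangent_of_component:
  assumes "v \<in> tangent_space A p" "c \<in> A" "p \<in> chart_dom c"
  shows "tangent_of A c p (v c) = v"
proof
  fix d show "tangent_of A c p (v c) d = v d"
  proof (cases "d \<in> A \<and> p \<in> chart_dom d")
    case True
    then have "v d = transition_deriv c d p (v c)"
      using assms unfolding tangent_space_def by blast
    then show ?thesis using True by (simp add: tangent_of_def)
  next
    case False
    then have "v d = 0" using assms(1) unfolding tangent_space_def by blast
    then show ?thesis using False by (auto simp: tangent_of_def)
  qed
qed

lemma metric_eq_local:
  assumes "v \<in> tangent_space A p" "c \<in> A" "p \<in> chart_dom c"
  shows "g p v v = local_metric A g c (chart_map c p) (v c) (v c)"
  using tangent_of_component[OF assms] chart_inv_map[OF assms(2,3)] by (simp add: local_metric_def)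

lemma open_tangent_bundle_base:
  assumes "open U"
  shows "open_tangent_bundle A {\<theta> \<in> tangent_bundle A. fst \<theta> \<in> U}"
  unfolding open_tangent_bundle_def
proof (intro conjI ballI)
  fix c assume c: "c \<in> A"
  have "bundle_chart c ` {\<theta> \<in> {\<theta> \<in> tangent_bundle A. fst \<theta> \<in> U}. fst \<theta> \<in> chart_dom c} =
    chart_map c ` (chart_dom c \<inter> U) \<times> UNIV" (is "?l = ?r")
  proof
    show "?r \<subseteq> ?l"
    proof clarify
      fix p u assume p: "p \<in> chart_dom c" "p \<in> U"
      have "(p, tangent_of A c p u) \<in> tangent_bundle A"
        using tangent_of_in(1)[OF c p(1)] c p by (auto simp: tangent_bundle_def manifold_carrier_def)
      moreover have "(chart_map c p, u) = bundle_chart c (p, tangent_of A c p u)"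
        using tangent_of_in(2)[OF c p(1)] by (simp add: bundle_chart_def)
      ultimately show "(chart_map c p, u) \<in> ?l" using p by (intro image_eqI) auto
    qed
  qed (auto simp: bundle_chart_def)
  then show "open (bundle_chart c ` {\<theta> \<in> {\<theta> \<in> tangent_bundle A. fst \<theta> \<in> U}. fst \<theta> \<in> chart_dom c})"
    using open_chart_map_image[OF c assms] by (simp add: open_Times)
qed auto

text \<open>Openness has to be checked in every chart \<open>d\<close>. There the set becomes the
  preimage of \<open>Q\<close> under \<Phi>, the coordinate change of the tangent bundle from
  \<open>d\<close> to \<open>c\<close>, which acts on vectors by the derivative and is jointly
  continuous.\<close>

lemma open_tangent_bundle_box:
  assumes c: "c \<in> A" and O: "open Q"
  shows "open_tangent_bundle A {\<theta> \<in> tangent_bundle A. fst \<theta> \<in> chart_dom c \<and> bundle_chart c \<theta> \<in> Q}"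
    (is "open_tangent_bundle A ?W")
  unfolding open_tangent_bundle_def
proof (intro conjI ballI)
  fix d assume d: "d \<in> A"
  define T where "T = chart_map d ` (chart_dom d \<inter> chart_dom c)"
  define \<tau> where "\<tau> = chart_map c \<circ> chart_inv d"
  define \<Phi> where "\<Phi> q = (\<tau> (fst q), frechet_derivative \<tau> (at (fst q)) (snd q))" for q
  have T: "open T" unfolding T_def by (rule open_chart_map_image[OF d open_chart_dom[OF c]])
  have sm: "smooth_on T \<tau>" unfolding T_def \<tau>_def by (rule transition_smooth[OF d c])
  have "continuous_on (T \<times> UNIV) \<Phi>"
    unfolding \<Phi>_def using continuous_on_frechet[OF sm]
    by (intro continuous_on_Pair continuous_on_compose2[OF smooth_on_continuous[OF sm]] continuous_intros)
      (auto simp: split_beta)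
  then have op: "open (T \<times> UNIV \<inter> \<Phi> -` Q)"
    by (rule continuous_open_preimage[OF _ open_Times[OF T open_UNIV] O])
  have \<Phi>: "\<Phi> (chart_map d p, u) = (chart_map c p, transition_deriv d c p u)"
    if "p \<in> chart_dom d" for p u
    using chart_inv_map[OF d that] by (simp add: \<Phi>_def \<tau>_def transition_deriv_def)
  have "bundle_chart d ` {\<theta> \<in> ?W. fst \<theta> \<in> chart_dom d} = T \<times> UNIV \<inter> \<Phi> -` Q" (is "?l = ?r")
  proof
    show "?l \<subseteq> ?r"
    proof (rule image_subsetI)
      fix \<theta> assume \<theta>: "\<theta> \<in> {\<theta> \<in> ?W. fst \<theta> \<in> chart_dom d}"
      obtain p v where pv: "\<theta> = (p, v)" by (cases \<theta>)
      with \<theta> have *: "(p, v) \<in> tangent_bundle A" "p \<in> chart_dom c"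
        "bundle_chart c (p, v) \<in> Q" "p \<in> chart_dom d" by auto
      then have "v c = transition_deriv d c p (v d)"
        using c d unfolding tangent_bundle_def tangent_space_def by blast
      then have "\<Phi> (bundle_chart d (p, v)) = bundle_chart c (p, v)"
        using \<Phi>[of p "v d"] * by (simp add: bundle_chart_def)
      then show "bundle_chart d \<theta> \<in> ?r" unfolding pv using * by (auto simp: bundle_chart_def T_def)
    qed
    show "?r \<subseteq> ?l"
    proof (rule subrelI)
      fix y u assume "(y, u) \<in> ?r"
      then have "y \<in> T" and Q: "(y, u) \<in> \<Phi> -` Q" by auto
      then obtain p where p: "y = chart_map d p" "p \<in> chart_dom d" "p \<in> chart_dom c"
        unfolding T_def by blast
      let ?v = "tangent_of A d p u"
      have "(p, ?v) \<in> tangent_bundle A"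
        using tangent_of_in(1)[OF d p(2)] d p by (auto simp: tangent_bundle_def manifold_carrier_def)
      moreover have "bundle_chart c (p, ?v) \<in> Q"
        using Q p \<Phi>[OF p(2), of u] c by (simp add: bundle_chart_def tangent_of_def)
      moreover have "(y, u) = bundle_chart d (p, ?v)"
        using tangent_of_in(2)[OF d p(2)] p(1) by (simp add: bundle_chart_def)
      ultimately show "(y, u) \<in> ?l" using p by (intro image_eqI) auto
    qed
  qed
  then show "open (bundle_chart d ` {\<theta> \<in> ?W. fst \<theta> \<in> chart_dom d})" using op by simp
qed auto

section \<open>Borel sets of unit vectors and positivity of the measure\<close>

lemma unit_tangent_bundle_iff:
  "\<theta> \<in> unit_tangent_bundle A g \<longleftrightarrow> \<theta> \<in> tangent_bundle A \<and> g (fst \<theta>) (snd \<theta>) (snd \<theta>) = 1"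
  by (cases \<theta>) (simp add: unit_tangent_bundle_def)

lemma borel_unit_tangent_bundleI:
  assumes "open_tangent_bundle A {\<theta> \<in> tangent_bundle A. P \<theta>}"
  shows "{\<theta> \<in> unit_tangent_bundle A g. P \<theta>} \<in> borel_unit_tangent_bundle A g"
proof -
  have "{\<theta> \<in> unit_tangent_bundle A g. P \<theta>} = {\<theta> \<in> tangent_bundle A. P \<theta>} \<inter> unit_tangent_bundle A g"
    by (auto simp: unit_tangent_bundle_iff)
  then show ?thesis unfolding borel_unit_tangent_bundle_def using assms by (auto intro!: sigma_sets.Basic)
qed

lemma continuous_on_local_metric:
  "c \<in> A \<Longrightarrow> continuous_on (chart_img c \<times> UNIV) (\<lambda>(x, u). local_metric A g c x u u)"
  by (rule local_riemannian.continuous_on_G[OF local_riemannian])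

lemma volume_density_pos:
  assumes "c \<in> A" "x \<in> chart_img c"
  shows "volume_density A g c x > 0"
proof -
  let ?G = "local_metric A g c x"
  have bil: "bilinear ?G" by (rule local_riemannian.bilinear_G[OF local_riemannian]) fact+
  have "u \<bullet> ((\<chi> i j. ?G (axis i 1) (axis j 1)) *v u) = ?G u u" for u
  proof -
    have "?G u u = (\<Sum>i\<in>UNIV. (u $ i) *\<^sub>R ?G (axis i 1) u)"
      by (rule linear_eq_sum_axis) (use bil in \<open>simp add: bilinear_def\<close>)
    also have "\<dots> = (\<Sum>i\<in>UNIV. (u $ i) *\<^sub>R (\<Sum>j\<in>UNIV. (u $ j) *\<^sub>R ?G (axis i 1) (axis j 1)))"
      by (intro sum.cong refl arg_cong2[of _ _ _ _ "(*\<^sub>R)"] linear_eq_sum_axis)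
        (use bil in \<open>simp add: bilinear_def\<close>)
    finally show ?thesis
      by (simp add: inner_vec_def matrix_vector_mult_def mult.commute)
  qed
  then show ?thesis
    unfolding volume_density_def
    using local_riemannian.pos_G[OF local_riemannian[OF assms(1)] assms(2)]
    by (simp add: det_pos_if_positive_definite)
qed

lemma continuous_on_volume_density:
  assumes "c \<in> A"
  shows "continuous_on (chart_img c) (volume_density A g c)"
proof -
  have "continuous_on (chart_img c) (\<lambda>x. local_metric A g c x u w)" for u w
    by (rule smooth_on_continuous[OF local_riemannian.smooth_G[OF local_riemannian[OF assms]]])
  then show ?thesis
    unfolding volume_density_def[abs_def] det_def by (intro continuous_intros) auto
qed

text \<open>This is what lets a property that holds almost everywhere produce a unit vector in any
  prescribed coordinate neighbourhood of a given one.\<close>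

lemma liouville_open_pos:
  assumes m: "is_liouville_measure A g m" and c: "c \<in> A" and Q: "open Q"
    and \<theta>: "\<theta> \<in> unit_tangent_bundle A g" "fst \<theta> \<in> chart_dom c" "bundle_chart c \<theta> \<in> Q"
  shows "emeasure m {\<theta> \<in> unit_tangent_bundle A g. fst \<theta> \<in> chart_dom c \<and> bundle_chart c \<theta> \<in> Q} > 0"
    (is "emeasure m ?B > 0")
proof -
  let ?G = "local_metric A g c"
  note lr = local_riemannian[OF c]
  define N where "N q = sqrt (?G (fst q) (snd q) (snd q))" for q
  define \<Psi> where "\<Psi> q = (fst q, (1 / N q) *\<^sub>R snd q)" for q
  define x0 where "x0 = chart_map c (fst \<theta>)"
  \<comment> \<open>The halved vector lies in the interior of the cone over the unit vectors near \<open>snd \<theta> c\<close>, so a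
    fixed open set \<open>V\<close> around it is contained in the cones over all nearby base points.  Bounding the
    integrand below by a constant also avoids showing that it is measurable.\<close>
  define z0 where "z0 = (1 / 2) *\<^sub>R snd \<theta> c"
  have x0: "x0 \<in> chart_img c" unfolding x0_def by (rule chart_map_in[OF c \<theta>(2)])
  have Ncont: "continuous_on (chart_img c \<times> UNIV) N"
    unfolding N_def using continuous_on_local_metric[OF c] by (intro continuous_intros) (simp add: split_beta)
  \<comment> \<open>Vectors of length strictly between 0 and 1. As \<Psi> is the radial projection
    to unit vectors, the part of \<open>Q1\<close> that \<Psi> sends into \<open>Q\<close> consists
    of points of the cones over the slices of \<open>Q\<close>, and it is open.\<close>
  define Q1 where "Q1 = chart_img c \<times> UNIV \<inter> N -` {0<..<1}"
  have Q1: "open Q1"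
    unfolding Q1_def by (intro continuous_open_preimage[OF Ncont] open_Times open_chart_img c) auto
  have "continuous_on Q1 \<Psi>"
    unfolding \<Psi>_def by (intro continuous_intros continuous_on_subset[OF Ncont]) (auto simp: Q1_def)
  then have Q2: "open (Q1 \<inter> \<Psi> -` Q)" by (rule continuous_open_preimage[OF _ Q1 Q])
  have "snd \<theta> \<in> tangent_space A (fst \<theta>)" "g (fst \<theta>) (snd \<theta>) (snd \<theta>) = 1"
    using \<theta>(1) by (auto simp: unit_tangent_bundle_iff tangent_bundle_def)
  then have unit: "?G x0 (snd \<theta> c) (snd \<theta> c) = 1"
    using metric_eq_local[OF _ c \<theta>(2)] by (simp add: x0_def)
  have N0: "N (x0, z0) = 1 / 2"
    using unit by (simp add: N_def z0_def local_riemannian.G_scale[OF lr x0] real_sqrt_divide real_sqrt_mult)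
  then have "(x0, z0) \<in> Q1 \<inter> \<Psi> -` Q"
    using \<theta>(3) x0 by (auto simp: Q1_def \<Psi>_def z0_def bundle_chart_def x0_def)
  then obtain U0 V where UV: "open U0" "open V" "x0 \<in> U0" "z0 \<in> V" "U0 \<times> V \<subseteq> Q1 \<inter> \<Psi> -` Q"
    using open_prod_elim[OF Q2] by (metis SigmaE2 mem_Sigma_iff)
  \<comment> \<open>Half of the density at \<open>x0\<close>, so that by continuity the density
    exceeds \<kappa> on a neighbourhood of \<open>x0\<close>.\<close>
  define \<kappa> where "\<kappa> = volume_density A g c x0 / 2"
  have \<kappa>: "\<kappa> > 0" "\<kappa> < volume_density A g c x0" using volume_density_pos[OF c x0] by (auto simp: \<kappa>_def)
  define U where "U = U0 \<inter> (chart_img c \<inter> volume_density A g c -` {\<kappa><..})"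
  have "open (chart_img c \<inter> volume_density A g c -` {\<kappa><..})"
    by (rule continuous_open_preimage[OF continuous_on_volume_density[OF c] open_chart_img[OF c]]) simp
  then have U: "open U" "x0 \<in> U" "U \<subseteq> U0" "U \<subseteq> chart_img c"
    unfolding U_def using UV x0 \<kappa> by auto
  have slice: "ennreal (real CARD('n) * \<kappa>) * emeasure lborel V \<le>
      unit_sphere_measure A g c x {v c | v. (chart_inv c x, v) \<in> ?B}" if x: "x \<in> U" for x
  proof -
    have xi: "x \<in> chart_img c" using x U by blast
    define p where "p = chart_inv c x"
    have p: "p \<in> chart_dom c" "chart_map c p = x"
      using chart_inv_in[OF c xi] chart_map_inv[OF c xi] by (auto simp: p_def)
    have slice_eq: "{v c | v. (p, v) \<in> ?B} = {w. (x, w) \<in> Q \<and> ?G x w w = 1}" (is "?l = ?r")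
    proof
      show "?l \<subseteq> ?r"
      proof
        fix w assume "w \<in> ?l"
        then have "\<exists>v. w = v c \<and> (p, v) \<in> ?B" by (rule CollectD)
        then obtain v where v: "w = v c" "(p, v) \<in> ?B" by (elim exE conjE)
        then have "v \<in> tangent_space A p" "g p v v = 1" "bundle_chart c (p, v) \<in> Q"
          by (auto simp: unit_tangent_bundle_iff tangent_bundle_def)
        then show "w \<in> ?r"
          using metric_eq_local[of v p c] c p v(1) by (simp add: bundle_chart_def)
      qed
      show "?r \<subseteq> ?l"
      proof
        fix w assume w: "w \<in> ?r"
        let ?v = "tangent_of A c p w"
        have "?v \<in> tangent_space A p" "?v c = w" using tangent_of_in[OF c p(1)] by auto
        then have "(p, ?v) \<in> ?B" "?v c = w"
          using w metric_eq_local[of ?v p c] c p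
          by (auto simp: unit_tangent_bundle_iff tangent_bundle_def bundle_chart_def manifold_carrier_def)
        then have "\<exists>v. w = v c \<and> (p, v) \<in> ?B" by (intro exI[of _ ?v]) simp
        then show "w \<in> ?l" by (rule CollectI)
      qed
    qed
    define n where "n z = N (x, z)" for z
    have n_cont: "continuous_on UNIV n"
      unfolding n_def by (intro continuous_on_compose2[OF Ncont] continuous_intros) (use xi in auto)
    have n_scale: "n (r *\<^sub>R w) = r * n w" if "r \<ge> 0" for r w
      using that by (simp add: n_def N_def local_riemannian.G_scale[OF lr xi] real_sqrt_mult)
    define cone where "cone = {r *\<^sub>R w | r w. 0 < r \<and> r \<le> 1 \<and> w \<in> {v c | v. (p, v) \<in> ?B}}"
    \<comment> \<open>The cone in polar coordinates, described through the continuous function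
      \<open>n\<close>. In this form it is visibly Borel, which monotonicity of the measure requires
      of the larger set.\<close>
    have cone_eq: "cone = {z. 0 < n z \<and> n z \<le> 1 \<and> (x, (1 / n z) *\<^sub>R z) \<in> Q}"
    proof (intro equalityI subsetI)
      fix z assume "z \<in> cone"
      then obtain r w where *: "z = r *\<^sub>R w" "0 < r" "r \<le> 1" "(x, w) \<in> Q" "?G x w w = 1"
        unfolding cone_def slice_eq by blast
      then have "n w = 1" by (simp add: n_def N_def)
      then show "z \<in> {z. 0 < n z \<and> n z \<le> 1 \<and> (x, (1 / n z) *\<^sub>R z) \<in> Q}"
        using * n_scale[of r w] by simp
    next
      fix z assume "z \<in> {z. 0 < n z \<and> n z \<le> 1 \<and> (x, (1 / n z) *\<^sub>R z) \<in> Q}"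
      then have z: "0 < n z" "n z \<le> 1" "(x, (1 / n z) *\<^sub>R z) \<in> Q" by auto
      let ?w = "(1 / n z) *\<^sub>R z"
      have "n ?w = 1" using n_scale[of "1 / n z" z] z by simp
      then have "?G x ?w ?w = 1" by (simp add: n_def N_def)
      moreover have "z = n z *\<^sub>R ?w" using z by simp
      ultimately show "z \<in> cone" unfolding cone_def slice_eq using z by blast
    qed
    have "n \<in> borel_measurable borel" by (rule borel_measurable_continuous_onI[OF n_cont])
    moreover have "Q \<in> sets borel" using Q by simp
    ultimately have "cone \<in> sets lborel" unfolding cone_eq by measurable
    moreover have "V \<subseteq> cone"
    proof
      fix z assume "z \<in> V"
      then have "(x, z) \<in> Q1 \<inter> \<Psi> -` Q" using UV(5) U(3) x by blast
      then show "z \<in> cone" unfolding cone_eq by (auto simp: Q1_def \<Psi>_def n_def)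
    qed
    ultimately have 1: "emeasure lborel V \<le> emeasure lborel cone" by (intro emeasure_mono)
    have 2: "ennreal (real CARD('n) * \<kappa>) \<le> ennreal (real CARD('n) * volume_density A g c x)"
      using x by (intro ennreal_leI mult_left_mono) (auto simp: U_def)
    show ?thesis
      unfolding unit_sphere_measure_def p_def[symmetric] cone_def[symmetric]
      by (rule mult_mono[OF 2 1]) auto
  qed
  \<comment> \<open>One factor \<kappa> bounds the volume density of the base, the other the density
    inside the measure of the sphere.\<close>
  define k where "k = ennreal \<kappa> * (ennreal (real CARD('n) * \<kappa>) * emeasure lborel V)"
  have "emeasure lborel V > 0" using UV by (intro emeasure_lborel_open_pos) auto
  then have k: "k > 0" unfolding k_def using \<kappa> by (simp add: ennreal_zero_less_mult_iff)
  have "?B \<in> sets m"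
    using m borel_unit_tangent_bundleI[OF open_tangent_bundle_box[OF c Q]]
    unfolding is_liouville_measure_def by blast
  moreover have "?B \<subseteq> {\<theta>. fst \<theta> \<in> chart_dom c}" by blast
  ultimately have "emeasure m ?B = (\<integral>\<^sup>+x\<in>chart_img c. ennreal (volume_density A g c x) *
      unit_sphere_measure A g c x {v c | v. (chart_inv c x, v) \<in> ?B} \<partial>lborel)"
    using m c unfolding is_liouville_measure_def by blast
  also have "\<dots> \<ge> (\<integral>\<^sup>+x. k * indicator U x \<partial>lborel)"
  proof (intro nn_integral_mono)
    fix x
    show "k * indicator U x \<le> ennreal (volume_density A g c x) *
        unit_sphere_measure A g c x {v c | v. (chart_inv c x, v) \<in> ?B} * indicator (chart_img c) x"
    proof (cases "x \<in> U")
      case True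
      then have "x \<in> chart_img c" "ennreal \<kappa> \<le> ennreal (volume_density A g c x)"
        using U by (auto simp: U_def intro!: ennreal_leI)
      then show ?thesis using True slice[OF True] unfolding k_def by (simp add: mult_mono)
    qed simp
  qed
  also have "(\<integral>\<^sup>+x. k * indicator U x \<partial>lborel) = k * emeasure lborel U"
    using U by (intro nn_integral_cmult_indicator) auto
  finally have *: "k * emeasure lborel U \<le> emeasure m ?B" .
  have "emeasure lborel U > 0" using U by (intro emeasure_lborel_open_pos) auto
  with k have "0 < k * emeasure lborel U" by (simp add: ennreal_zero_less_mult_iff)
  then show ?thesis using * by (rule order_less_le_trans)
qed

end

section \<open>Convex functions under a conservative geodesic flow\<close>

locale convex_on_conservative = riemannian_manifold A g
  for A :: "('a::{t2_space, second_countable_topology}, 'n::finite) chart set"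
    and g :: "('a, 'n) metric" +
  fixes m :: "('a \<times> ('a, 'n) tangent) measure" and f :: "'a \<Rightarrow> real"
  assumes complete: "geodesically_complete A g"
    and liouville: "is_liouville_measure A g m"
    and conservative: "conservative m (geodesic_flow A g)"
    and continuous: "continuous_on (manifold_carrier A) f"
    and convex: "geodesically_convex A g f"
begin

lemma open_manifold_carrier: "open (manifold_carrier A)"
  unfolding manifold_carrier_def using open_chart_dom by blast

lemma AE_constant_along_geodesic:
  "AE \<theta> in m. \<forall>t\<ge>0. f (the_geodesic A g \<theta> t) = f (fst \<theta>)"
proof -
  \<comment> \<open>Recurrence to the countably many sets where \<open>f\<close> takes values in a rational interval suffices;
    recurrence to neighbourhoods of \<open>\<theta>\<close> is not needed.\<close>
  define U where "U a b = manifold_carrier A \<inter> f -` {of_rat a<..<of_rat b}" for a b :: rat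
  define B where "B a b = {\<theta> \<in> unit_tangent_bundle A g. fst \<theta> \<in> U a b}" for a b
  have "open (U a b)" for a b
    unfolding U_def by (rule continuous_open_preimage[OF continuous open_manifold_carrier]) simp
  then have "B a b \<in> sets m" for a b
    using borel_unit_tangent_bundleI[OF open_tangent_bundle_base] liouville
    unfolding is_liouville_measure_def B_def by blast
  then have "AE \<theta> in m. \<theta> \<in> B a b \<longrightarrow> (\<exists>t :: nat \<Rightarrow> real. filterlim t at_top sequentially \<and>
      (\<forall>n. geodesic_flow A g (t n) \<theta> \<in> B a b))" for a b
    using conservative unfolding conservative_def by blast
  then have rec: "AE \<theta> in m. \<forall>a b. \<theta> \<in> B a b \<longrightarrow> (\<exists>t :: nat \<Rightarrow> real. filterlim t at_top sequentially \<and>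
      (\<forall>n. geodesic_flow A g (t n) \<theta> \<in> B a b))"
    by (simp add: AE_all_countable)
  show ?thesis
    using AE_space rec
  proof eventually_elim
    fix \<theta>
    assume "\<theta> \<in> space m" and rec: "\<forall>a b. \<theta> \<in> B a b \<longrightarrow> (\<exists>t :: nat \<Rightarrow> real.
      filterlim t at_top sequentially \<and> (\<forall>n. geodesic_flow A g (t n) \<theta> \<in> B a b))"
    then have \<theta>: "\<theta> \<in> unit_tangent_bundle A g" "\<theta> \<in> tangent_bundle A"
      using liouville by (auto simp: is_liouville_measure_def unit_tangent_bundle_iff)
    note \<gamma> = the_geodesic[OF complete \<theta>(2)]
    show "\<forall>t\<ge>0. f (the_geodesic A g \<theta> t) = f (fst \<theta>)"
    proof (intro allI impI)
      fix t :: real assume "0 \<le> t"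
      have "f (the_geodesic A g \<theta> t) = f (the_geodesic A g \<theta> 0)"
      proof (rule recurrent_convex_constant[OF _ _ \<open>0 \<le> t\<close>])
        fix a b \<tau> :: real assume "a < b" "\<tau> \<in> {0..1}"
        then show "f (the_geodesic A g \<theta> ((1 - \<tau>) * a + \<tau> * b)) \<le>
            (1 - \<tau>) * f (the_geodesic A g \<theta> a) + \<tau> * f (the_geodesic A g \<theta> b)"
          using convex geodesic_on_subinterval[OF \<gamma>(1)] unfolding geodesically_convex_def by blast
      next
        fix a b :: rat
        assume "of_rat a < f (the_geodesic A g \<theta> 0)" "f (the_geodesic A g \<theta> 0) < of_rat b"
        then have "\<theta> \<in> B a b"
          using \<theta> \<gamma>(2) by (auto simp: B_def U_def tangent_bundle_def)
        then obtain s :: "nat \<Rightarrow> real" where "filterlim s at_top sequentially"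
          "\<And>n. geodesic_flow A g (s n) \<theta> \<in> B a b" using rec by blast
        then show "\<exists>s :: nat \<Rightarrow> real. filterlim s at_top sequentially \<and>
            (\<forall>n. of_rat a < f (the_geodesic A g \<theta> (s n)) \<and> f (the_geodesic A g \<theta> (s n)) < of_rat b)"
          by (intro exI[of _ s]) (auto simp: B_def U_def geodesic_flow_def)
      qed
      then show "f (the_geodesic A g \<theta> t) = f (fst \<theta>)" using \<gamma>(2) by simp
    qed
  qed
qed

text \<open>A property that holds almost everywhere is realised in every set of positive measure, in
  particular in the balls of radius \<open>1 / Suc k\<close> around \<theta> in the bundle chart.
  Convergence in this one chart is what the later estimates use.\<close>

lemma dense_constant:
  assumes c: "c \<in> A" and \<theta>: "\<theta> \<in> unit_tangent_bundle A g" "fst \<theta> \<in> chart_dom c"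
  obtains \<theta>' :: "nat \<Rightarrow> 'a \<times> ('a, 'n) tangent" where
    "\<And>k. \<theta>' k \<in> unit_tangent_bundle A g" "\<And>k. fst (\<theta>' k) \<in> chart_dom c"
    "(\<lambda>k. bundle_chart c (\<theta>' k)) \<longlonglongrightarrow> bundle_chart c \<theta>"
    "\<And>k t. t \<ge> 0 \<Longrightarrow> f (the_geodesic A g (\<theta>' k) t) = f (fst (\<theta>' k))"
proof -
  define Q where "Q k = ball (bundle_chart c \<theta>) (1 / real (Suc k))" for k
  have Q: "open (Q k)" "bundle_chart c \<theta> \<in> Q k" for k by (auto simp: Q_def)
  have "\<exists>\<theta>'\<in>{\<theta> \<in> unit_tangent_bundle A g. fst \<theta> \<in> chart_dom c \<and> bundle_chart c \<theta> \<in> Q k}.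
      \<forall>t\<ge>0. f (the_geodesic A g \<theta>' t) = f (fst \<theta>')" for k
    using AE_ex_in_positive_set[OF AE_constant_along_geodesic _ liouville_open_pos[OF liouville c Q(1) \<theta> Q(2)]]
      borel_unit_tangent_bundleI[OF open_tangent_bundle_box[OF c Q(1)]] liouville
    unfolding is_liouville_measure_def by blast
  then obtain \<theta>' where \<theta>': "\<And>k. \<theta>' k \<in> unit_tangent_bundle A g \<and> fst (\<theta>' k) \<in> chart_dom c \<and>
      bundle_chart c (\<theta>' k) \<in> Q k \<and> (\<forall>t\<ge>0. f (the_geodesic A g (\<theta>' k) t) = f (fst (\<theta>' k)))"
    by (metis (no_types, lifting) mem_Collect_eq)
  have "norm (bundle_chart c (\<theta>' k) - bundle_chart c \<theta>) \<le> inverse (real (Suc k))" for k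
    using \<theta>'[of k] by (simp add: Q_def dist_norm norm_minus_commute inverse_eq_divide)
  then have "(\<lambda>k. bundle_chart c (\<theta>' k) - bundle_chart c \<theta>) \<longlonglongrightarrow> 0"
    by (intro Lim_null_comparison[OF _ LIMSEQ_inverse_real_of_nat] always_eventually allI)
  then have "(\<lambda>k. bundle_chart c (\<theta>' k)) \<longlonglongrightarrow> bundle_chart c \<theta>" by (rule Lim_null[THEN iffD2])
  then show ?thesis using that[of \<theta>'] \<theta>' by blast
qed

lemma locally_constant:
  assumes c: "c \<in> A" and p: "p \<in> chart_dom c"
  shows "\<exists>V. open V \<and> p \<in> V \<and> V \<subseteq> manifold_carrier A \<and> (\<forall>q\<in>V. f q = f p)"
proof -
  note lr = local_riemannian[OF c]
  let ?G = "local_metric A g c"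

  \<comment> \<open>Coordinate bounds near \<open>p\<close>\<close>
  define x where "x = chart_map c p"
  have x: "x \<in> chart_img c" unfolding x_def by (rule chart_map_in[OF c p])
  obtain r0 where r0: "r0 > 0" "cball x r0 \<subseteq> chart_img c" by (rule ex_cball_chart_img[OF c x])
  obtain \<mu> where \<mu>: "\<mu> > 0" "\<And>y u. y \<in> cball x r0 \<Longrightarrow> ?G y u u \<ge> \<mu> * (norm u)\<^sup>2"
    using local_riemannian.G_elliptic[OF lr compact_cball convex_cball r0(2)] by blast
  \<comment> \<open>By ellipticity, every vector of unit length for the metric at a base point in
    \<open>cball x r0\<close> has coordinate norm at most \<open>1 / sqrt \<mu>\<close>. Thus one
    \<open>R\<close> serves all unit vectors near \<open>p\<close>.\<close>
  define R where "R = 1 / sqrt \<mu>"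
  have R: "R \<ge> 0" using \<mu> by (simp add: R_def)
  have unit_bound: "norm u \<le> R" if "y \<in> cball x r0" "?G y u u = 1" for y u
  proof -
    have "(norm u)\<^sup>2 \<le> R\<^sup>2"
      using \<mu>(2)[OF that(1), of u] \<mu>(1) unfolding that(2)
      by (simp add: R_def power_divide pos_le_divide_eq mult.commute)
    then show ?thesis by (rule power2_le_imp_le[OF _ R])
  qed
  obtain r \<epsilon> C M where r: "r > 0" and \<epsilon>: "\<epsilon> > 0" and C: "C \<ge> 0" and M: "M \<ge> 0"
    and short: "\<And>\<gamma> t. geodesic_on A g UNIV \<gamma> \<Longrightarrow> \<gamma> 0 \<in> chart_dom c \<Longrightarrow>
      dist x (chart_map c (\<gamma> 0)) \<le> r \<Longrightarrow> norm (velocity A UNIV \<gamma> 0 c) \<le> R \<Longrightarrow> t \<in> {0..\<epsilon>} \<Longrightarrow>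
      \<gamma> t \<in> chart_dom c \<and>
      norm (chart_map c (\<gamma> t) - chart_map c (\<gamma> 0) - t *\<^sub>R velocity A UNIV \<gamma> 0 c) \<le> C * t\<^sup>2"
    and gron: "\<And>\<gamma> \<gamma>' t. geodesic_on A g UNIV \<gamma> \<Longrightarrow> \<gamma> 0 \<in> chart_dom c \<Longrightarrow>
      dist x (chart_map c (\<gamma> 0)) \<le> r \<Longrightarrow> norm (velocity A UNIV \<gamma> 0 c) \<le> R \<Longrightarrow>
      geodesic_on A g UNIV \<gamma>' \<Longrightarrow> \<gamma>' 0 \<in> chart_dom c \<Longrightarrow>
      dist x (chart_map c (\<gamma>' 0)) \<le> r \<Longrightarrow> norm (velocity A UNIV \<gamma>' 0 c) \<le> R \<Longrightarrow> t \<in> {0..\<epsilon>} \<Longrightarrow>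
      norm (chart_map c (\<gamma> t) - chart_map c (\<gamma>' t)) \<le> M * norm (state c \<gamma> 0 - state c \<gamma>' 0)"
    by (rule short_geodesics[OF c x R]) (rule that; assumption)
  have init: "geodesic_on A g UNIV (the_geodesic A g \<theta>)" "the_geodesic A g \<theta> 0 \<in> chart_dom c"
      "dist x (chart_map c (the_geodesic A g \<theta> 0)) \<le> r"
      "norm (velocity A UNIV (the_geodesic A g \<theta>) 0 c) \<le> R"
      "state c (the_geodesic A g \<theta>) 0 = bundle_chart c \<theta>"
    if \<theta>: "\<theta> \<in> unit_tangent_bundle A g" "fst \<theta> \<in> chart_dom c" "dist x (chart_map c (fst \<theta>)) \<le> min r r0"
    for \<theta>
  proof -
    have T: "\<theta> \<in> tangent_bundle A" "snd \<theta> \<in> tangent_space A (fst \<theta>)" "g (fst \<theta>) (snd \<theta>) (snd \<theta>) = 1"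
      using \<theta>(1) by (auto simp: unit_tangent_bundle_iff tangent_bundle_def)
    note \<gamma> = the_geodesic[OF complete T(1)]
    show "geodesic_on A g UNIV (the_geodesic A g \<theta>)" by (rule \<gamma>(1))
    show "the_geodesic A g \<theta> 0 \<in> chart_dom c" "dist x (chart_map c (the_geodesic A g \<theta> 0)) \<le> r"
      using \<theta> \<gamma>(2) by auto
    have "?G (chart_map c (fst \<theta>)) (snd \<theta> c) (snd \<theta> c) = 1"
      using metric_eq_local[OF T(2) c \<theta>(2)] T(3) by simp
    then show "norm (velocity A UNIV (the_geodesic A g \<theta>) 0 c) \<le> R"
      unfolding \<gamma>(3) by (rule unit_bound[rotated]) (use \<theta>(3) in auto)
    show "state c (the_geodesic A g \<theta>) 0 = bundle_chart c \<theta>"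
      by (simp add: state_def bundle_chart_def \<gamma>(2,3))
  qed

  \<comment> \<open>Constancy of \<open>f\<close> along short geodesics from
    \<open>p\<close>\<close>
  have fc: "continuous_on (chart_img c) (\<lambda>y. f (chart_inv c y))"
    by (rule continuous_on_compose2[OF continuous continuous_on_chart_inv[OF c]])
      (use chart_inv_in[OF c] c in \<open>auto simp: manifold_carrier_def\<close>)
  \<comment> \<open>The vector \<theta> may itself be exceptional, so it is approximated by good
    vectors, whose base points in general differ from \<open>p\<close>. The values of
    \<open>f\<close> at time \<open>t\<close> and at time 0 agree along the sequence; they tend to
    \<open>f (the_geodesic A g \<theta> t)\<close> and \<open>f p\<close>.\<close>
  have const: "f (the_geodesic A g \<theta> t) = f p"
    if \<theta>: "\<theta> \<in> unit_tangent_bundle A g" "fst \<theta> = p" and t: "t \<in> {0..\<epsilon>}" for \<theta> t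
  proof -
    have dom: "fst \<theta> \<in> chart_dom c" using \<theta>(2) p by simp
    obtain \<theta>' where \<theta>': "\<And>k. \<theta>' k \<in> unit_tangent_bundle A g" "\<And>k. fst (\<theta>' k) \<in> chart_dom c"
      "(\<lambda>k. bundle_chart c (\<theta>' k)) \<longlonglongrightarrow> bundle_chart c \<theta>"
      "\<And>k t. t \<ge> 0 \<Longrightarrow> f (the_geodesic A g (\<theta>' k) t) = f (fst (\<theta>' k))"
      using dense_constant[OF c \<theta>(1) dom] by metis
    have lim0: "(\<lambda>k. chart_map c (fst (\<theta>' k))) \<longlonglongrightarrow> x"
      using tendsto_fst[OF \<theta>'(3)] \<theta>(2) by (simp add: bundle_chart_def x_def)
    have init\<theta>: "dist x (chart_map c (fst \<theta>)) \<le> min r r0" using \<theta>(2) r r0 by (simp add: x_def)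
    note i = init[OF \<theta>(1) dom init\<theta>]
    have "\<forall>\<^sub>F k in sequentially. dist (chart_map c (fst (\<theta>' k))) x < min r r0"
      using tendstoD[OF lim0, of "min r r0"] r r0 by simp
    then have ev: "\<forall>\<^sub>F k in sequentially. the_geodesic A g (\<theta>' k) t \<in> chart_dom c \<and>
        norm (chart_map c (the_geodesic A g (\<theta>' k) t) - chart_map c (the_geodesic A g \<theta> t)) \<le>
          norm (bundle_chart c (\<theta>' k) - bundle_chart c \<theta>) * M"
    proof eventually_elim
      fix k assume "dist (chart_map c (fst (\<theta>' k))) x < min r r0"
      then have "dist x (chart_map c (fst (\<theta>' k))) \<le> min r r0" by (simp add: dist_commute)
      note k = init[OF \<theta>'(1,2) this]
      show "the_geodesic A g (\<theta>' k) t \<in> chart_dom c \<and>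
        norm (chart_map c (the_geodesic A g (\<theta>' k) t) - chart_map c (the_geodesic A g \<theta> t)) \<le>
          norm (bundle_chart c (\<theta>' k) - bundle_chart c \<theta>) * M"
        using short[OF k(1-4) t] gron[OF k(1-4) i(1-4) t] unfolding k(5) i(5) by (simp add: mult.commute)
    qed
    have it: "the_geodesic A g \<theta> t \<in> chart_dom c" using short[OF i(1-4) t] by blast
    have "(\<lambda>k. chart_map c (the_geodesic A g (\<theta>' k) t)) \<longlonglongrightarrow> chart_map c (the_geodesic A g \<theta> t)"
    proof (rule Lim_null[THEN iffD2], rule Lim_null_comparison)
      show "\<forall>\<^sub>F k in sequentially.
          norm (chart_map c (the_geodesic A g (\<theta>' k) t) - chart_map c (the_geodesic A g \<theta> t)) \<le>
            norm (bundle_chart c (\<theta>' k) - bundle_chart c \<theta>) * M"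
        using ev by (rule eventually_mono) blast
      show "(\<lambda>k. norm (bundle_chart c (\<theta>' k) - bundle_chart c \<theta>) * M) \<longlonglongrightarrow> 0"
        using tendsto_mult_left_zero[OF tendsto_norm_zero[OF Lim_null[THEN iffD1, OF \<theta>'(3)]]] .
    qed
    moreover have "\<forall>\<^sub>F k in sequentially. chart_map c (the_geodesic A g (\<theta>' k) t) \<in> chart_img c"
      using ev by (rule eventually_mono) (use chart_map_in[OF c] in blast)
    ultimately have "(\<lambda>k. f (chart_inv c (chart_map c (the_geodesic A g (\<theta>' k) t)))) \<longlonglongrightarrow>
        f (chart_inv c (chart_map c (the_geodesic A g \<theta> t)))"
      by (rule continuous_on_tendsto_compose[OF fc _ chart_map_in[OF c it]])
    then have "(\<lambda>k. f (chart_inv c (chart_map c (the_geodesic A g (\<theta>' k) t)))) \<longlonglongrightarrow> f (the_geodesic A g \<theta> t)"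
      unfolding chart_inv_map[OF c it] .
    moreover have "\<forall>\<^sub>F k in sequentially. f (chart_inv c (chart_map c (the_geodesic A g (\<theta>' k) t))) = f (fst (\<theta>' k))"
      using ev by eventually_elim (use \<theta>'(4) t chart_inv_map[OF c] in auto)
    ultimately have "(\<lambda>k. f (fst (\<theta>' k))) \<longlonglongrightarrow> f (the_geodesic A g \<theta> t)"
      by (rule Lim_transform_eventually)
    moreover have "(\<lambda>k. f (chart_inv c (chart_map c (fst (\<theta>' k))))) \<longlonglongrightarrow> f (chart_inv c x)"
      by (rule continuous_on_tendsto_compose[OF fc lim0 x]) (simp add: chart_map_in[OF c] \<theta>'(2))
    then have "(\<lambda>k. f (fst (\<theta>' k))) \<longlonglongrightarrow> f p"
      by (simp add: chart_inv_map[OF c] \<theta>'(2) x_def p)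
    ultimately show ?thesis by (rule LIMSEQ_unique)
  qed

  \<comment> \<open>The exponential map at \<open>p\<close> in coordinates\<close>
  obtain B where B: "B > 0" "\<And>u w. norm (?G x u w) \<le> norm u * norm w * B"
    using bounded_bilinear.pos_bounded local_riemannian.bilinear_G[OF lr x]
    unfolding bilinear_conv_bounded_bilinear by metis
  define n where "n u = sqrt (?G x u u)" for u
  have n2: "(n u)\<^sup>2 = ?G x u u" for u
    using local_riemannian.G_nonneg[OF lr x] by (simp add: n_def)
  have n_pos: "n u > 0" if "u \<noteq> 0" for u
    using local_riemannian.pos_G[OF lr x that] by (simp add: n_def)
  have n_nonneg: "n u \<ge> 0" for u using local_riemannian.G_nonneg[OF lr x] by (simp add: n_def)
  have n2_le: "(n u)\<^sup>2 \<le> B * (norm u)\<^sup>2" for u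
    using B(2)[of u u] unfolding n2 by (simp add: power2_eq_square mult_ac)
  have n_le: "n u \<le> sqrt B * norm u" for u
    using real_sqrt_le_mono[OF n2_le[of u]] n_nonneg[of u] by (simp add: real_sqrt_mult)
  have n_cont: "isCont n u" for u
  proof -
    have "continuous_on UNIV (\<lambda>u. case (x, u) of (y, u) \<Rightarrow> ?G y u u)"
      by (rule continuous_on_compose2[OF continuous_on_local_metric[OF c]])
        (use x in \<open>auto intro!: continuous_intros\<close>)
    then have "isCont (\<lambda>u. ?G x u u) u" by (simp add: continuous_on_eq_continuous_at)
    then show ?thesis unfolding n_def[abs_def] by (intro continuous_intros)
  qed
  \<comment> \<open>The unit vector in direction \<open>u\<close>. For \<open>u = 0\<close> division
    by zero yields the zero vector, which is not a unit vector; hence the conditions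
    \<open>u \<noteq> 0\<close> below.\<close>
  define \<theta> where "\<theta> u = (p, tangent_of A c p ((1 / n u) *\<^sub>R u))" for u
  have \<theta>_unit: "\<theta> u \<in> unit_tangent_bundle A g" if "u \<noteq> 0" for u
  proof -
    let ?w = "(1 / n u) *\<^sub>R u"
    have "?G x ?w ?w = (1 / n u) * ((1 / n u) * (n u)\<^sup>2)"
      unfolding n2 by (simp only: local_riemannian.G_scale[OF lr x])
    then have "?G x ?w ?w = 1" using n_pos[OF that] by (simp add: power2_eq_square)
    then show ?thesis
      using metric_eq_local[OF tangent_of_in(1)[OF c p] c p, of ?w] tangent_of_in[OF c p] c p
      by (auto simp: \<theta>_def unit_tangent_bundle_iff tangent_bundle_def manifold_carrier_def x_def)
  qed
  have \<theta>_chart: "bundle_chart c (\<theta> u) = (x, (1 / n u) *\<^sub>R u)" for u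
    using tangent_of_in(2)[OF c p] by (simp add: \<theta>_def bundle_chart_def x_def)
  define \<gamma> where "\<gamma> u = the_geodesic A g (\<theta> u)" for u
  have \<gamma>: "geodesic_on A g UNIV (\<gamma> u)" "\<gamma> u 0 \<in> chart_dom c" "dist x (chart_map c (\<gamma> u 0)) \<le> r"
      "norm (velocity A UNIV (\<gamma> u) 0 c) \<le> R" "state c (\<gamma> u) 0 = (x, (1 / n u) *\<^sub>R u)"
    if "u \<noteq> 0" for u
    unfolding \<gamma>_def using init[OF \<theta>_unit[OF that]] p r r0 \<theta>_chart by (auto simp: \<theta>_def x_def)
  \<comment> \<open>Unit speed for time \<open>n u\<close> replaces speed \<open>n u\<close> for
    time 1, since \<open>const\<close> concerns unit vectors. This polar form degenerates at
    \<open>u = 0\<close>, where the value is prescribed.\<close>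
  define E where "E u = (if u = 0 then x else chart_map c (\<gamma> u (n u)))" for u
  \<comment> \<open>The first entry gives \<open>n u \<le> \<epsilon>\<close>, as
    \<open>n u \<le> sqrt B * norm u\<close>. The second gives
    \<open>C * B * \<rho> \<le> 1 / 2\<close>, so the quadratic error is at most
    \<open>\<rho> / 2\<close>; its summand 1 avoids division by zero when
    \<open>C = 0\<close>.\<close>
  define \<rho> where "\<rho> = min (\<epsilon> / sqrt B) (1 / (2 * (C * B + 1)))"
  have \<rho>: "\<rho> > 0" unfolding \<rho>_def using \<epsilon> B C by (simp add: add_nonneg_pos)
  have time: "n u \<in> {0..\<epsilon>}" if "u \<in> cball 0 \<rho>" for u
  proof -
    have "norm u \<le> \<epsilon> / sqrt B" using that by (simp add: \<rho>_def)
    then have "sqrt B * norm u \<le> \<epsilon>" using B(1) by (simp add: pos_le_divide_eq mult.commute)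
    then show ?thesis using n_le[of u] n_nonneg[of u] by simp
  qed
  \<comment> \<open>The estimate \<open>short\<close> at time \<open>n u\<close>: the initial
    velocity is \<open>(1 / n u) *\<^sub>R u\<close>, so the linear term is exactly
    \<open>u\<close>.\<close>
  have E_approx: "norm (E u - x - u) \<le> C * B * (norm u)\<^sup>2" if u: "u \<in> cball 0 \<rho>" for u
  proof (cases "u = 0")
    case False
    have "norm (E u - x - u) \<le> C * (n u)\<^sup>2"
      using short[OF \<gamma>(1-4)[OF False] time[OF u]] \<gamma>(5)[OF False] n_pos[OF False] False
      by (simp add: E_def state_def)
    also have "\<dots> \<le> C * (B * (norm u)\<^sup>2)" by (rule mult_left_mono[OF n2_le C])
    finally show ?thesis by (simp add: mult.assoc)
  qed (simp add: E_def)
  \<comment> \<open>At 0 continuity follows from \<open>E_approx\<close>. At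
    \<open>u \<noteq> 0\<close> the difference is split at the point
    \<open>\<gamma> u (n w)\<close>: Gronwall's inequality handles the change of direction at the
    common time \<open>n w\<close>, continuity of \<open>\<gamma> u\<close> the change of
    time.\<close>
  have E_cont: "continuous_on (cball 0 \<rho>) E"
    unfolding continuous_on_def
  proof
    fix u :: "real ^ 'n" assume u: "u \<in> cball 0 \<rho>"
    let ?F = "at u within cball 0 \<rho>"
    have ball: "\<forall>\<^sub>F w in ?F. w \<in> cball 0 \<rho>" by (simp add: eventually_at_filter)
    show "(E \<longlongrightarrow> E u) ?F"
    proof (cases "u = 0")
      case True
      have "((\<lambda>w. norm w + C * B * (norm w)\<^sup>2) \<longlongrightarrow> norm u + C * B * (norm u)\<^sup>2) ?F"
        by (intro tendsto_intros)
      then have lim: "((\<lambda>w. norm w + C * B * (norm w)\<^sup>2) \<longlongrightarrow> 0) ?F" using True by simp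
      have "\<forall>\<^sub>F w in ?F. norm (E w - E u) \<le> norm w + C * B * (norm w)\<^sup>2"
        using ball
      proof eventually_elim
        fix w :: "real ^ 'n" assume "w \<in> cball 0 \<rho>"
        have "norm (E w - x) \<le> norm w + norm (E w - x - w)"
          using norm_triangle_ineq[of w "E w - x - w"] by simp
        moreover have "E u = x" using True by (simp add: E_def)
        ultimately show "norm (E w - E u) \<le> norm w + C * B * (norm w)\<^sup>2"
          using E_approx[OF \<open>w \<in> cball 0 \<rho>\<close>] by simp
      qed
      from Lim_null_comparison[OF this lim] have "((\<lambda>w. E w - E u) \<longlongrightarrow> 0) ?F" .
      then show ?thesis by (rule Lim_null[THEN iffD2])
    next
      case False
      have n_lim: "(n \<longlongrightarrow> n u) ?F"
        by (rule tendsto_mono[OF at_le n_cont[unfolded isCont_def]]) simp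
      have dom: "\<gamma> u (n u) \<in> chart_dom c" using short[OF \<gamma>(1-4)[OF False] time[OF u]] by blast
      have "isCont (\<lambda>t. fst (state c (\<gamma> u) t)) (n u)"
        by (intro continuous_intros has_vector_derivative_continuous[OF
              state_has_vector_derivative[OF \<gamma>(1)[OF False] c dom]])
      then have lim1: "((\<lambda>w. fst (state c (\<gamma> u) (n w))) \<longlongrightarrow> fst (state c (\<gamma> u) (n u))) ?F"
        by (rule isCont_tendsto_compose[OF _ n_lim])
      have lim2: "((\<lambda>w. (1 / n w) *\<^sub>R w) \<longlongrightarrow> (1 / n u) *\<^sub>R u) ?F"
        using n_pos[OF False] by (intro tendsto_intros n_lim) simp
      have "((\<lambda>w. M * norm ((1 / n w) *\<^sub>R w - (1 / n u) *\<^sub>R u) +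
            norm (fst (state c (\<gamma> u) (n w)) - fst (state c (\<gamma> u) (n u)))) \<longlongrightarrow>
          M * norm ((1 / n u) *\<^sub>R u - (1 / n u) *\<^sub>R u) +
            norm (fst (state c (\<gamma> u) (n u)) - fst (state c (\<gamma> u) (n u)))) ?F"
        by (rule tendsto_add[OF tendsto_mult[OF tendsto_const tendsto_norm[OF
                tendsto_diff[OF lim2 tendsto_const]]] tendsto_norm[OF tendsto_diff[OF lim1 tendsto_const]]])
      then have lim: "((\<lambda>w. M * norm ((1 / n w) *\<^sub>R w - (1 / n u) *\<^sub>R u) +
            norm (fst (state c (\<gamma> u) (n w)) - fst (state c (\<gamma> u) (n u)))) \<longlongrightarrow> 0) ?F"
        by simp
      have "\<forall>\<^sub>F w in ?F. w \<noteq> 0"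
        using tendsto_imp_eventually_ne[OF tendsto_ident_at False] .
      with ball have "\<forall>\<^sub>F w in ?F. norm (E w - E u) \<le> M * norm ((1 / n w) *\<^sub>R w - (1 / n u) *\<^sub>R u) +
            norm (fst (state c (\<gamma> u) (n w)) - fst (state c (\<gamma> u) (n u)))"
      proof eventually_elim
        fix w :: "real ^ 'n" assume w: "w \<in> cball 0 \<rho>" "w \<noteq> 0"
        have "norm (chart_map c (\<gamma> w (n w)) - chart_map c (\<gamma> u (n w))) \<le>
            M * norm ((1 / n w) *\<^sub>R w - (1 / n u) *\<^sub>R u)"
          using gron[OF \<gamma>(1-4)[OF w(2)] \<gamma>(1-4)[OF False] time[OF w(1)]]
          unfolding \<gamma>(5)[OF w(2)] \<gamma>(5)[OF False] by (simp add: norm_Pair)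
        then show "norm (E w - E u) \<le> M * norm ((1 / n w) *\<^sub>R w - (1 / n u) *\<^sub>R u) +
            norm (fst (state c (\<gamma> u) (n w)) - fst (state c (\<gamma> u) (n u)))"
          using w(2) False norm_triangle_ineq[of "chart_map c (\<gamma> w (n w)) - chart_map c (\<gamma> u (n w))"
              "chart_map c (\<gamma> u (n w)) - chart_map c (\<gamma> u (n u))"]
          by (simp add: E_def state_def)
      qed
      from Lim_null_comparison[OF this lim] have "((\<lambda>w. E w - E u) \<longlongrightarrow> 0) ?F" .
      then show ?thesis by (rule Lim_null[THEN iffD2])
    qed
  qed
  \<comment> \<open>\<open>E\<close> is the exponential map at \<open>p\<close> read in the chart; being quadratically close to \<open>u \<mapsto> x + u\<close>,
    it covers a neighbourhood of \<open>x\<close> by Brouwer's theorem, so its smoothness is not needed.\<close>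
  have surj: "\<exists>y\<in>cball 0 \<rho>. E y - x = z" if z: "z \<in> ball 0 (\<rho> / 2)" for z
  proof (rule brouwer_surjective[where S = "ball 0 (\<rho> / 2)"])
    show "compact (cball (0::real^'n) \<rho>)" "convex (cball (0::real^'n) \<rho>)" by auto
    show "cball (0::real^'n) \<rho> \<noteq> {}" using \<rho> by simp
    show "continuous_on (cball 0 \<rho>) (\<lambda>y. E y - x)" by (intro continuous_intros E_cont)
    \<comment> \<open>A fixed point of this map in \<open>y\<close> solves
      \<open>E y - x = z'\<close>. The ball is preserved because \<open>z'\<close> contributes less
      than \<open>\<rho> / 2\<close> and the quadratic error at most
      \<open>\<rho> / 2\<close>.\<close>
    show "z' + (y - (E y - x)) \<in> cball 0 \<rho>" if z': "z' \<in> ball 0 (\<rho> / 2)" and y: "y \<in> cball 0 \<rho>" for z' y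
    proof -
      have "C * B * \<rho> \<le> 1 / 2"
      proof -
        have le: "q * (1 / (2 * (q + 1))) \<le> 1 / 2" if "q \<ge> 0" for q :: real
          using that by (simp add: pos_divide_le_eq)
        have "C * B * \<rho> \<le> C * B * (1 / (2 * (C * B + 1)))"
          using C B(1) by (intro mult_left_mono) (auto simp: \<rho>_def)
        also have "\<dots> \<le> 1 / 2"
          by (rule le) (use C B(1) in simp)
        finally show ?thesis .
      qed
      then have half: "C * B * \<rho> * \<rho> \<le> \<rho> / 2" using \<rho> mult_right_mono[of "C * B * \<rho>" "1 / 2" \<rho>] by simp
      have "norm (y - (E y - x)) = norm (E y - x - y)" by (rule norm_minus_commute)
      also have "\<dots> \<le> C * B * (norm y)\<^sup>2" by (rule E_approx[OF y])
      also have "\<dots> \<le> C * B * \<rho>\<^sup>2" using y C B(1) by (intro mult_left_mono power_mono) auto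
      also have "\<dots> \<le> \<rho> / 2" using half by (simp add: power2_eq_square mult.assoc)
      finally show ?thesis using z' norm_triangle_ineq[of z' "y - (E y - x)"] by simp
    qed
  qed (rule z)

  \<comment> \<open>A neighbourhood of \<open>p\<close> on which \<open>f\<close> is
    constant\<close>
  have img: "y \<in> chart_img c \<and> f (chart_inv c y) = f p" if y: "y \<in> ball x (\<rho> / 2)" for y
  proof -
    obtain u where u: "u \<in> cball 0 \<rho>" "E u - x = y - x"
      using surj[of "y - x"] y by (auto simp: dist_norm norm_minus_commute)
    then have Eu: "y = E u" by simp
    show ?thesis
    proof (cases "u = 0")
      case True
      then show ?thesis using Eu x chart_inv_map[OF c p] by (simp add: E_def x_def)
    next
      case False
      have dom: "\<gamma> u (n u) \<in> chart_dom c" using short[OF \<gamma>(1-4)[OF False] time[OF u(1)]] by blast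
      have "f (\<gamma> u (n u)) = f p"
        unfolding \<gamma>_def by (rule const[OF \<theta>_unit[OF False] _ time[OF u(1)]]) (simp add: \<theta>_def)
      then show ?thesis
        using Eu False chart_inv_map[OF c dom] chart_map_in[OF c dom] by (simp add: E_def)
    qed
  qed
  let ?V = "chart_inv c ` ball x (\<rho> / 2)"
  have sub: "ball x (\<rho> / 2) \<subseteq> chart_img c" using img by blast
  have "open ?V" by (rule open_chart_inv_image[OF c open_ball sub])
  moreover have "p \<in> ?V"
    unfolding chart_inv_image[OF c sub] using p \<rho> by (simp add: x_def)
  moreover have "?V \<subseteq> manifold_carrier A"
    unfolding chart_inv_image[OF c sub] using c by (auto simp: manifold_carrier_def)
  moreover have "\<forall>q\<in>?V. f q = f p" using img by blast
  ultimately show ?thesis by blast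
qed

lemma constant_on_manifold:
  assumes "connected (manifold_carrier A)"
  shows "f constant_on manifold_carrier A"
proof (rule locally_constant_imp_constant[OF assms])
  fix p assume "p \<in> manifold_carrier A"
  then obtain c where "c \<in> A" "p \<in> chart_dom c" by (auto simp: manifold_carrier_def)
  from locally_constant[OF this]
  show "\<exists>T. openin (top_of_set (manifold_carrier A)) T \<and> p \<in> T \<and> (\<forall>x\<in>T. f x = f p)"
    by (meson open_subset)
qed

end

theorem theorem1:
  fixes A :: "('a::{t2_space, second_countable_topology}, 'n::finite) chart set"
    and g :: "('a, 'n) metric"
    and m :: "('a \<times> ('a, 'n) tangent) measure"
    and f :: "'a \<Rightarrow> real"
  assumes "smooth_atlas A"
    and "connected (manifold_carrier A)"
    and "riemannian_metric A g"
    and "geodesically_complete A g"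
    and "is_liouville_measure A g m"
    and "conservative m (geodesic_flow A g)"
    and "continuous_on (manifold_carrier A) f"
    and "geodesically_convex A g f"
  shows "f constant_on manifold_carrier A"
proof -
  interpret convex_on_conservative A g m f
    by unfold_locales (use assms in blast)+
  show ?thesis by (rule constant_on_manifold[OF assms(2)])
qed

end
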